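(* Let $G$ be a graph with no isolated vertices, and let $d, s_1, s_2, \ldots, s_d$ be positive integers. Assume $0 < \operatorname{mr}_+(G) \leq d \leq |V(G)|$. Suppose there exist $d$ mutually orthogonal vectors $z_1, z_2, \ldots, z_d$ such that, if $Z = [z_1, z_2, \ldots, z_d]$ (the matrix with these columns), then $ZZ^T \in \mathcal{S}(G)$ and $q(ZZ^T) = 2$. Then $$q\big(G \vee (K_{s_1} \cup K_{s_2} \cup \cdots \cup K_{s_d})\big) = 2;$$ moreover, $$MB\big(G \vee (K_{s_1} \cup K_{s_2} \cup \cdots \cup K_{s_d})\big) = d.$$
   Context: All graphs are finite and simple. For a graph $G$ on $n$ vertices, $\mathcal{S}(G)$ is the set of real symmetric $n\times n$ matrices $A=[a_{ij}]$ (rows and columns indexed by the vertices) such that for $i\neq j$, $a_{ij}\neq 0$ if and only if $ij$ is an edge of $G$; the diagonal entries are arbitrary. For a symmetric matrix $A$, $q(A)$ is the number of distinct eigenvalues of $A$, and $q(G)=\min\{q(A): A\in\mathcal{S}(G)\}$. $\operatorname{mr}_+(G)$ is the minimum rank among all positive semidefinite matrices in $\mathcal{S}(G)$. A graph $G$ on $n$ vertices achieves the multiplicity bipartition $[n-k,k]$, where $1\le k\leq\lfloor n/2\rfloor$, if some $A\in\mathcal{S}(G)$ has exactly two distinct eigenvalues, with multiplicities $n-k$ and $k$. For a graph $G$ that admits a matrix in $\mathcal{S}(G)$ with exactly two distinct eigenvalues, $MB(G)$ is the least integer $k\leq \lfloor n/2\rfloor$ such that $G$ achieves $[n-k,k]$.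 $G\vee H$ denotes the join (disjoint union of $G$ and $H$ plus all edges between $V(G)$ and $V(H)$), $\cup$ denotes disjoint union of graphs, and $K_s$ is the complete graph on $s$ vertices.
   Formalization: The mutually orthogonal vectors z_1,…,z_d are required to be nonzero; with zero vectors allowed the claim fails, e.g. for G = 2K_2, d = 3, all s_i = 1, z = (1,1,0,0), (0,0,1,1), 0, where MB is not 3. *)

theory Defs
  imports
    "Graph_Theory.Pair_Digraph"
    "Jordan_Normal_Form.Spectral_Radius"
    "Jordan_Normal_Form.DL_Rank"
begin

text \<open>
  Finite simple graphs are the \<^locale>\<open>pair_graph\<close>s of the Graph Theory library: finite, loop-free
  and symmetric, the edge \<open>uv\<close> being represented by the two arcs \<open>(u,v)\<close> and \<open>(v,u)\<close>.
\<close>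

definition no_isolated_vertices :: "'a pair_pre_digraph \<Rightarrow> bool" where
  "no_isolated_vertices G \<longleftrightarrow> (\<forall>v\<in>pverts G. \<exists>u\<in>pverts G. (v, u) \<in> parcs G)"

definition complete_graph :: "nat \<Rightarrow> nat pair_pre_digraph" where
  "complete_graph n = \<lparr>pverts = {..<n}, parcs = {(u, v). u < n \<and> v < n \<and> u \<noteq> v}\<rparr>"

definition disjoint_union :: "'i set \<Rightarrow> ('i \<Rightarrow> 'a pair_pre_digraph) \<Rightarrow> ('i \<times> 'a) pair_pre_digraph" where
  "disjoint_union I H =
    \<lparr>pverts = (SIGMA i:I. pverts (H i)),
     parcs = {((i, u), (j, v)) | i u j v. i \<in> I \<and> j = i \<and> (u, v) \<in> parcs (H i)}\<rparr>"

definition graph_join :: "'a pair_pre_digraph \<Rightarrow> 'b pair_pre_digraph \<Rightarrow> ('a + 'b) pair_pre_digraph" where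
  "graph_join G H =
    \<lparr>pverts = pverts G <+> pverts H,
     parcs = {(Inl u, Inl v) | u v. (u, v) \<in> parcs G}
           \<union> {(Inr u, Inr v) | u v. (u, v) \<in> parcs H}
           \<union> {(Inl u, Inr v) | u v. u \<in> pverts G \<and> v \<in> pverts H}
           \<union> {(Inr v, Inl u) | u v. u \<in> pverts G \<and> v \<in> pverts H}\<rparr>"

lemma pair_graph_complete_graph: "pair_graph (complete_graph n)"
proof unfold_locales
  have "parcs (complete_graph n) \<subseteq> {..<n} \<times> {..<n}" by (auto simp: complete_graph_def)
  then show "finite (parcs (complete_graph n))" by (rule finite_subset) simp
qed (auto simp: complete_graph_def symmetric_def sym_def)

lemma pair_graph_disjoint_union:
  assumes "finite I" and H: "\<And>i. i \<in> I \<Longrightarrow> pair_graph (H i)"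
  shows "pair_graph (disjoint_union I H)"
proof -
  have wf: "u \<in> pverts (H i)" "v \<in> pverts (H i)" "(v, u) \<in> parcs (H i)" "u \<noteq> v"
    if "i \<in> I" "(u, v) \<in> parcs (H i)" for i u v
  proof -
    interpret pair_graph "H i" by (rule H) fact
    show "u \<in> pverts (H i)" "v \<in> pverts (H i)" "(v, u) \<in> parcs (H i)" "u \<noteq> v"
      using that pair_sym_arcs pair_no_loops[of "(u, v)"] wellformed'[of u v]
      by (auto simp: symmetric_def sym_def)
  qed
  have fin: "finite (pverts (disjoint_union I H))"
    using assms by (auto simp: disjoint_union_def pair_graph_def pair_digraph_def
        pair_fin_digraph_def pair_fin_digraph_axioms_def)
  show ?thesis
  proof unfold_locales
    have "parcs (disjoint_union I H) \<subseteq> pverts (disjoint_union I H) \<times> pverts (disjoint_union I H)"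
      using wf by (auto simp: disjoint_union_def)
    then show "finite (parcs (disjoint_union I H))" by (rule finite_subset) (simp add: fin)
  qed (use fin wf in \<open>auto simp: disjoint_union_def symmetric_def sym_def\<close>)
qed

lemma pair_graph_join:
  assumes "pair_graph G" and "pair_graph H"
  shows "pair_graph (graph_join G H)"
proof -
  interpret G: pair_graph G by fact
  interpret H: pair_graph H by fact
  have G: "u \<in> pverts G" "v \<in> pverts G" "(v, u) \<in> parcs G" "u \<noteq> v" if "(u, v) \<in> parcs G" for u v
    using that G.pair_sym_arcs G.pair_no_loops[of "(u, v)"] G.wellformed'[of u v]
    by (auto simp: symmetric_def sym_def)
  have H: "u \<in> pverts H" "v \<in> pverts H" "(v, u) \<in> parcs H" "u \<noteq> v" if "(u, v) \<in> parcs H" for u v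
    using that H.pair_sym_arcs H.pair_no_loops[of "(u, v)"] H.wellformed'[of u v]
    by (auto simp: symmetric_def sym_def)
  have fin: "finite (pverts (graph_join G H))" by (simp add: graph_join_def)
  show ?thesis
  proof unfold_locales
    have "parcs (graph_join G H) \<subseteq> pverts (graph_join G H) \<times> pverts (graph_join G H)"
      using G H by (auto simp: graph_join_def)
    then show "finite (parcs (graph_join G H))" by (rule finite_subset) (simp add: fin)
  qed (use fin G H in \<open>auto simp: graph_join_def symmetric_def sym_def\<close>)
qed

text \<open>
  Matrices are indexed by \<open>0, \<dots>, n - 1\<close>, so rows and columns are attached to the vertices by an
  enumeration \<open>vs\<close> of the vertex set.  No enumeration is singled out: the set below contains the
  matrices obtained from all of them, i.e. it is closed under simultaneous permutations of rows and
  columns, and the parameters defined from it do not depend on the enumeration.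
\<close>

definition matrices_of :: "'a pair_pre_digraph \<Rightarrow> real mat set" (\<open>\<S>\<close>) where
  "\<S> G = {A. \<exists>vs. distinct vs \<and> set vs = pverts G
      \<and> A \<in> carrier_mat (length vs) (length vs) \<and> A\<^sup>T = A
      \<and> (\<forall>i < length vs. \<forall>j < length vs.
            i \<noteq> j \<longrightarrow> (A $$ (i, j) \<noteq> 0 \<longleftrightarrow> (vs ! i, vs ! j) \<in> parcs G))}"

text \<open>
  In the following minima over sets of natural numbers, \<^const>\<open>Inf\<close> is the least element if the set
  is nonempty, and \<open>0\<close> otherwise.  All matrices considered are symmetric, so that all their
  eigenvalues are real and their algebraic and geometric multiplicities agree.
\<close>

definition q_mat :: "real mat \<Rightarrow> nat" where
  "q_mat A = card (spectrum A)"

definition q_graph :: "'a pair_pre_digraph \<Rightarrow> nat" where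
  "q_graph G = Inf (q_mat ` \<S> G)"

definition pos_semidef :: "real mat \<Rightarrow> bool" where
  "pos_semidef A \<longleftrightarrow> square_mat A \<and> A\<^sup>T = A
     \<and> (\<forall>x \<in> carrier_vec (dim_row A). 0 \<le> x \<bullet> (A *\<^sub>v x))"

definition mr_plus :: "'a pair_pre_digraph \<Rightarrow> nat" where
  "mr_plus G = Inf {vec_space.rank (dim_row A) A | A. A \<in> \<S> G \<and> pos_semidef A}"

definition achieves_bipartition :: "'a pair_pre_digraph \<Rightarrow> nat \<Rightarrow> bool" where
  "achieves_bipartition G k \<longleftrightarrow> 1 \<le> k \<and> k \<le> card (pverts G) div 2
     \<and> (\<exists>A \<in> \<S> G. \<exists>a b. a \<noteq> b \<and> spectrum A = {a, b}
          \<and> Polynomial.order a (char_poly A) = card (pverts G) - k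
          \<and> Polynomial.order b (char_poly A) = k)"

definition MB :: "'a pair_pre_digraph \<Rightarrow> nat" where
  "MB G = Inf {k. achieves_bipartition G k}"

text \<open>
  Mutual orthogonality of vectors is \<^const>\<open>orthogonal\<close> from the Jordan Normal Form library, which
  includes that the vectors are nonzero.  For the intended theorem this matters: for \<open>G = 2K\<^sub>2\<close>,
  \<open>d = 3\<close> and the columns \<open>(1,1,0,0)\<close>, \<open>(0,0,1,1)\<close>, \<open>0\<close> its conclusion fails.
\<close>

end

theory Submission
  imports Defs
begin

text \<open>
  If \<open>W\<close> has \<open>d\<close> orthogonal columns of equal norm, \<open>W W\<^sup>T\<close> has two eigenvalues, the nonzero one of
  multiplicity \<open>d\<close>.  For \<open>W W\<^sup>T\<close> to have the pattern of the join, give each vertex of the \<open>i\<close>-th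
  clique a multiple of \<open>e\<^sub>i\<close> as its row, which adjusts the norm of column \<open>i\<close>, and give \<open>G\<close> the rows
  of \<open>Z\<close>, once these have no zero entry.  To remove the zero entries, rotate columns of \<open>Z\<close> of equal
  norm among each other: this changes neither \<open>Z Z\<^sup>T\<close> nor \<open>Z\<^sup>T Z\<close>.  It succeeds because a row of \<open>Z\<close>
  that vanishes on an entire norm class would belong to an isolated vertex, as \<open>Z Z\<^sup>T\<close> has only two
  eigenvalues.

  Conversely, let \<open>A\<close> have eigenvalues \<open>a\<close> and \<open>b\<close>, the latter of multiplicity \<open>k\<close>.  Then \<open>A - a I\<close> is
  \<open>b - a\<close> times a Gram matrix of vectors in \<open>\<real>\<^sup>k\<close>.  One vertex from each clique gives \<open>d\<close> pairwise
  orthogonal vectors, which are nonzero as no vertex is isolated, so \<open>d \<le> k\<close>.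
\<close>

section \<open>Orthogonal diagonalization of real symmetric matrices\<close>

text \<open>A complex eigenvector \<open>v\<close> exists because \<open>n > 0\<close>. The
  Hermitian form \<open>S\<close> equals its own conjugate by symmetry and is \<open>k\<close> times
  the positive number \<open>N\<close>, so \<open>k\<close> is real and a root of the real
  characteristic polynomial.\<close>

lemma symmetric_real_mat_has_eigenvalue:
  fixes A :: "real mat"
  assumes A: "A \<in> carrier_mat n n" and sym: "A\<^sup>T = A" and n: "n > 0"
  shows "\<exists>k. eigenvalue A k"
proof -
  define B where "B = map_mat complex_of_real A"
  have B: "B \<in> carrier_mat n n" using A by (simp add: B_def)
  have Bij: "B $$ (i, j) = complex_of_real (A $$ (i, j))" if "i < n" "j < n" for i j
    using A that by (simp add: B_def)
  have Asym: "A $$ (i, j) = A $$ (j, i)" if "i < n" "j < n" for i j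
    using A that by (metis carrier_matD index_transpose_mat(1) sym)
  obtain k where "eigenvalue B k" using spectrum_non_empty[OF B n] by (auto simp: spectrum_def)
  then obtain v where v: "v \<in> carrier_vec n" "v \<noteq> 0\<^sub>v n" and Bv: "B *\<^sub>v v = k \<cdot>\<^sub>v v"
    using B by (auto simp: eigenvalue_def eigenvector_def)
  have row: "(\<Sum>j<n. B $$ (i, j) * v $ j) = k * v $ i" if "i < n" for i
  proof -
    have "(B *\<^sub>v v) $ i = k * v $ i" using Bv v that by simp
    then show ?thesis using B v that by (simp add: scalar_prod_def lessThan_atLeast0)
  qed
  define S where "S = (\<Sum>i<n. \<Sum>j<n. cnj (v $ i) * B $$ (i, j) * v $ j)"
  define N where "N = (\<Sum>i<n. (cmod (v $ i))\<^sup>2)"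
  have "S = (\<Sum>i<n. cnj (v $ i) * (k * v $ i))"
    by (simp add: S_def row[symmetric] sum_distrib_left mult.assoc)
  also have "\<dots> = (\<Sum>i<n. k * complex_of_real ((cmod (v $ i))\<^sup>2))"
    by (rule sum.cong) (simp_all add: complex_norm_square mult_ac del: of_real_power)
  finally have S: "S = k * complex_of_real N" by (simp add: N_def sum_distrib_left)
  have "cnj S = (\<Sum>i<n. \<Sum>j<n. cnj (v $ j) * B $$ (j, i) * v $ i)"
    unfolding S_def cnj_sum
    by (intro sum.cong refl) (simp add: Bij Asym mult_ac)
  also have "\<dots> = S" unfolding S_def by (rule sum.swap)
  finally have "cnj S = S" .
  obtain i where "i < n" "v $ i \<noteq> 0" using v by (metis eq_vecI carrier_vecD index_zero_vec)
  then have "N > 0" unfolding N_def by (intro sum_pos2[of _ i]) auto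
  with S \<open>cnj S = S\<close> have "cnj k = k" by simp
  then have "k \<in> \<real>" by (simp add: Reals_cnj_iff)
  then obtain r where r: "k = complex_of_real r" by (auto elim: Reals_cases)
  have "poly (char_poly B) k = 0"
    using \<open>eigenvalue B k\<close> eigenvalue_root_char_poly[OF B] by simp
  then have "poly (map_poly complex_of_real (char_poly A)) (complex_of_real r) = 0"
    using A by (simp add: B_def r of_real_hom.char_poly_hom[OF A])
  then have "poly (char_poly A) r = 0" by (simp add: of_real_hom.poly_map_poly)
  then show ?thesis using eigenvalue_root_char_poly[OF A] by blast
qed

text \<open>
  The Householder reflection along \<open>v - e\<^sub>0\<close>.  If \<open>v = e\<^sub>0\<close>, the coefficient is \<open>2 / 0 = 0\<close> and the
  matrix is the identity.
\<close>
lemma householder_mat: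
  fixes v :: "real vec"
  assumes v: "v \<in> carrier_vec n" and unit: "v \<bullet> v = 1" and n: "n > 0"
  obtains H where "H \<in> carrier_mat n n" "H\<^sup>T = H" "H * H = 1\<^sub>m n" "col H 0 = v"
proof -
  define u where "u i = v $ i - (if i = 0 then 1 else 0)" for i
  define s where "s = (\<Sum>i<n. u i * u i)"
  define a where "a = 2 / s"
  define H where "H = mat n n (\<lambda>(i, j). (if i = j then 1 else 0) - a * u i * u j)"
  have H: "H \<in> carrier_mat n n" by (simp add: H_def)
  have HT: "H\<^sup>T = H" by (rule eq_matI) (auto simp: H_def)
  \<comment> \<open>Also true for \<open>s = 0\<close>, where \<open>a = 0\<close> by division by
    zero.\<close>
  have aas: "a * a * s = 2 * a" by (simp add: a_def)
  have HH: "(H * H) $$ (i, j) = (if i = j then 1 else 0)" if "i < n" "j < n" for i j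
  proof -
    have "(H * H) $$ (i, j) = (\<Sum>k<n. ((if i = k then 1 else 0) - a * u i * u k)
        * ((if k = j then 1 else 0) - a * u k * u j))"
      using that by (simp add: H_def scalar_prod_def lessThan_atLeast0)
    also have "\<dots> = (\<Sum>k<n. (if i = k then (if k = j then 1 else 0) - a * u k * u j else 0)
        - (if k = j then a * u i * u k else 0) + a * a * u i * u j * (u k * u k))"
      by (rule sum.cong) (auto simp: algebra_simps)
    also have "\<dots> = (if i = j then 1 else 0) - 2 * a * u i * u j + (a * a * s) * u i * u j"
      using that by (simp add: sum.distrib sum_subtractf s_def sum_distrib_left sum_distrib_right
          algebra_simps)
    also have "\<dots> = (if i = j then 1 else 0)" by (simp add: aas)
    finally show ?thesis .
  qed
  \<comment> \<open>The unit norm of \<open>v\<close> gives \<open>s = - 2 * u 0\<close>. Hence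
    column 0 of \<open>H\<close>, the first unit vector minus \<open>a * u 0\<close> times
    \<open>u\<close>, is the first unit vector plus \<open>u\<close>, which is
    \<open>v\<close>.\<close>
  have vv: "(\<Sum>i<n. v $ i * v $ i) = 1"
    using unit v by (simp add: scalar_prod_def lessThan_atLeast0)
  have "s = (\<Sum>i<n. v $ i * v $ i - (if i = 0 then 2 * v $ i - 1 else 0))"
    unfolding s_def u_def by (rule sum.cong) (auto simp: algebra_simps)
  then have s: "s = - 2 * u 0" using n by (simp add: sum_subtractf vv u_def)
  have au: "a * u 0 * u i = - u i" if "i < n" for i
  proof (cases "s = 0")
    case True
    then have "u i = 0" using that by (auto simp: s_def sum_nonneg_eq_0_iff)
    then show ?thesis by simp
  next
    case False then show ?thesis by (simp add: a_def s)
  qed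
  show ?thesis
  proof
    show "H * H = 1\<^sub>m n" by (rule eq_matI) (use H HH in auto)
    show "col H 0 = v"
    proof (rule eq_vecI)
      fix i assume "i < dim_vec v"
      then show "col H 0 $ i = v $ i" using v n au[of i]
        by (auto simp: H_def mult_ac) (auto simp: u_def)
    qed (use v H in auto)
  qed (fact H HT)+
qed

text \<open>Deflation by induction on \<open>n\<close>: a reflection \<open>H\<close> whose first
  column is a unit eigenvector turns \<open>A\<close> into a block matrix with diagonal blocks
  \<open>k\<close> and a symmetric \<open>C\<close>. As \<open>H\<close> is symmetric and its own
  inverse, it serves as both conjugating factors, and the composed inverse is again a
  transpose.\<close>

theorem real_symmetric_orthogonally_diagonalizable:
  fixes A :: "real mat"
  assumes "A \<in> carrier_mat n n" and "A\<^sup>T = A"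
  shows "\<exists>D P. similar_mat_wit A D P P\<^sup>T \<and> diagonal_mat D"
  using assms
proof (induction n arbitrary: A)
  case 0
  then show ?case
    by (intro exI[of _ A] exI[of _ "1\<^sub>m 0"] conjI)
      (auto intro: similar_mat_wit_refl simp: diagonal_mat_def similar_mat_wit_def)
next
  case (Suc n)
  note A = Suc.prems(1) and sym = Suc.prems(2)
  obtain k v where v: "v \<in> carrier_vec (Suc n)" "v \<noteq> 0\<^sub>v (Suc n)" and Av: "A *\<^sub>v v = k \<cdot>\<^sub>v v"
    using symmetric_real_mat_has_eigenvalue[OF A sym] A by (auto simp: eigenvalue_def eigenvector_def)
  define w where "w = (1 / sqrt (v \<bullet> v)) \<cdot>\<^sub>v v"
  have pos: "v \<bullet> v > 0" using conjugate_square_greater_0_vec[OF v(1)] v(2) by simp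
  have w: "w \<in> carrier_vec (Suc n)" using v by (simp add: w_def)
  have "w \<bullet> w = 1" using v pos by (simp add: w_def)
  have Aw: "A *\<^sub>v w = k \<cdot>\<^sub>v w"
    using v A Av by (simp add: w_def mult_mat_vec smult_smult_assoc mult.commute)
  obtain H where H: "H \<in> carrier_mat (Suc n) (Suc n)" "H\<^sup>T = H" "H * H = 1\<^sub>m (Suc n)" "col H 0 = w"
    using householder_mat[OF w \<open>w \<bullet> w = 1\<close>] by auto
  define B where "B = H * A * H"
  have B: "B \<in> carrier_mat (Suc n) (Suc n)" using A H by (simp add: B_def)
  have BT: "B\<^sup>T = B" using A H sym
    by (simp add: B_def transpose_mult[of _ "Suc n" "Suc n" _ "Suc n"] assoc_mult_mat[of _ "Suc n" "Suc n" _ "Suc n" _ "Suc n"])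
  have simA: "similar_mat_wit A B H H"
  proof (rule similar_mat_witI[of _ _ "Suc n"])
    have "H * B * H = (H * H) * A * (H * H)"
      using A H(1) by (simp add: B_def assoc_mult_mat[of _ "Suc n" "Suc n" _ "Suc n" _ "Suc n"])
    then show "A = H * B * H" using A H by simp
  qed (use A B H in auto)
  have "B = H * (A * H)" using A H(1) by (simp add: B_def assoc_mult_mat[of _ "Suc n" "Suc n" _ "Suc n" _ "Suc n"])
  \<comment> \<open>\<open>H\<close> maps the first unit vector to \<open>w\<close> and, being an
    involution, maps \<open>w\<close> back, so the first column of \<open>B\<close> is
    \<open>k\<close> times the first unit vector.\<close>
  then have "col B 0 = H *\<^sub>v (A *\<^sub>v w)"
    using col_mult2[of H "Suc n" "Suc n" "A * H" "Suc n" 0] col_mult2[of A "Suc n" "Suc n" H "Suc n" 0] A H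
    by (simp del: col_mult)
  also have "\<dots> = k \<cdot>\<^sub>v (H *\<^sub>v w)" using A H w by (simp add: Aw mult_mat_vec)
  also have "H *\<^sub>v w = col (H * H) 0" using col_mult2[OF H(1) H(1), of 0] H(4) by simp
  finally have colB: "col B 0 = k \<cdot>\<^sub>v col (1\<^sub>m (Suc n)) 0" by (simp add: H(3))
  have B0: "B $$ (i, 0) = (if i = 0 then k else 0)" if "i < Suc n" for i
  proof -
    have "col B 0 $ i = B $$ (i, 0)" using B that by simp
    then show ?thesis using colB that by (auto split: if_splits)
  qed
  have Bsym: "B $$ (i, j) = B $$ (j, i)" if "i < Suc n" "j < Suc n" for i j
    using B that by (metis carrier_matD index_transpose_mat(1) BT)
  define C where "C = mat n n (\<lambda>(i, j). B $$ (Suc i, Suc j))"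
  have C: "C \<in> carrier_mat n n" "C\<^sup>T = C" by (auto simp: C_def Bsym intro!: eq_matI)
  have Bblock: "B = four_block_mat (mat 1 1 (\<lambda>_. k)) (0\<^sub>m 1 n) (0\<^sub>m n 1) C"
    by (rule eq_matI) (use B B0 Bsym[of 0] in \<open>auto simp: C_def\<close>)
  obtain D P where D: "similar_mat_wit C D P P\<^sup>T" "diagonal_mat D" using Suc.IH[OF C] by blast
  have Dc: "D \<in> carrier_mat n n" "P \<in> carrier_mat n n" using similar_mat_witD2[OF C(1) D(1)] by auto
  define D' where "D' = four_block_mat (mat 1 1 (\<lambda>_. k)) (0\<^sub>m 1 n) (0\<^sub>m n 1) D"
  define P' where "P' = four_block_mat (1\<^sub>m 1) (0\<^sub>m 1 n) (0\<^sub>m n 1) P"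
  have P': "P' \<in> carrier_mat (Suc n) (Suc n)" using four_block_carrier_mat[of "1\<^sub>m 1" 1 1 P n n] Dc by (simp add: P'_def)
  have "P'\<^sup>T = four_block_mat (1\<^sub>m 1) (0\<^sub>m 1 n) (0\<^sub>m n 1) P\<^sup>T"
    unfolding P'_def by (subst transpose_four_block_mat[of _ 1 1 _ n _ n]) (use Dc in auto)
  moreover have "similar_mat_wit B D' P' (four_block_mat (1\<^sub>m 1) (0\<^sub>m 1 n) (0\<^sub>m n 1) P\<^sup>T)"
    unfolding Bblock D'_def P'_def
    by (rule similar_mat_wit_four_block[OF similar_mat_wit_refl[of _ 1] D(1), where n = 1 and m = n])
      (use Dc C in auto)
  ultimately have "similar_mat_wit B D' P' P'\<^sup>T" by simp
  from similar_mat_wit_trans[OF simA this]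
  have "similar_mat_wit A D' (H * P') ((H * P')\<^sup>T)"
    using H P' by (simp add: transpose_mult[of _ "Suc n" "Suc n" _ "Suc n"])
  moreover have "diagonal_mat D'"
    using D(2) Dc by (auto simp: diagonal_mat_def D'_def)
  ultimately show ?case by blast
qed

lemma order_linear_prod_list:
  fixes xs :: "real list"
  shows "Polynomial.order b (\<Prod>a\<leftarrow>xs. [:- a, 1:]) = length (filter (\<lambda>a. a = b) xs)"
proof (induction xs)
  case (Cons a xs)
  have "(\<Prod>a\<leftarrow>a # xs. [:- a, 1:]) \<noteq> (0 :: real poly)" unfolding prod_list_zero_iff by auto
  then have "Polynomial.order b (\<Prod>a\<leftarrow>a # xs. [:- a, 1:])
      = Polynomial.order b [:- a, 1:] + Polynomial.order b (\<Prod>a\<leftarrow>xs. [:- a, 1:])"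
    by (simp del: mult_pCons_left add: order_mult)
  moreover have "Polynomial.order b [:- a, 1:] = (if a = b then 1 else 0)"
    using order_linear_power[of b "- a" 1] by auto
  ultimately show ?case using Cons.IH by simp
qed simp

text \<open>Scalar form of the diagonalization, with \<open>p x l\<close> the entry at
  \<open>x\<close> of the \<open>l\<close>-th eigenvector. Row orthonormality writes the identity
  matrix as a sum over \<open>l\<close>; column orthonormality lets \<open>A\<close> be applied to a
  single eigenvector.\<close>

corollary real_symmetric_spectral_decomposition:
  fixes A :: "real mat"
  assumes A: "A \<in> carrier_mat n n" and sym: "A\<^sup>T = A"
  obtains lam :: "nat \<Rightarrow> real" and p :: "nat \<Rightarrow> nat \<Rightarrow> real" where
    "\<And>x y. x < n \<Longrightarrow> y < n \<Longrightarrow> (\<Sum>l<n. p x l * p y l) = (if x = y then 1 else 0)"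
    "\<And>l m. l < n \<Longrightarrow> m < n \<Longrightarrow> (\<Sum>x<n. p x l * p x m) = (if l = m then 1 else 0)"
    "\<And>x y. x < n \<Longrightarrow> y < n \<Longrightarrow> A $$ (x, y) = (\<Sum>l<n. lam l * p x l * p y l)"
    "spectrum A = lam ` {..<n}"
    "\<And>b. Polynomial.order b (char_poly A) = card {l. l < n \<and> lam l = b}"
proof -
  obtain D P where sim: "similar_mat_wit A D P P\<^sup>T" and D: "diagonal_mat D"
    using real_symmetric_orthogonally_diagonalizable[OF A sym] by blast
  note w = similar_mat_witD2[OF A sim]
  define lam where "lam l = D $$ (l, l)" for l
  define p where "p x l = P $$ (x, l)" for x l
  have D0: "D $$ (i, j) = 0" if "i < n" "j < n" "i \<noteq> j" for i j
    using D w that by (simp add: diagonal_mat_def)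
  have "char_poly A = char_poly D" using sim by (intro char_poly_similar) (auto simp: similar_mat_def)
  also have "\<dots> = (\<Prod>a\<leftarrow>diag_mat D. [:- a, 1:])"
    by (rule char_poly_upper_triangular[OF w(5)]) (use D0 w in \<open>auto simp: upper_triangular_def\<close>)
  also have "diag_mat D = map lam [0..<n]" using w by (simp add: diag_mat_def lam_def)
  finally have cp: "char_poly A = (\<Prod>a\<leftarrow>map lam [0..<n]. [:- a, 1:])" .
  show thesis
  proof
    fix x y assume xy: "x < n" "y < n"
    have "(P * P\<^sup>T) $$ (x, y) = (\<Sum>l<n. p x l * p y l)"
      using w(4-7) xy by (simp add: scalar_prod_def lessThan_atLeast0 p_def)
    then show "(\<Sum>l<n. p x l * p y l) = (if x = y then 1 else 0)" using xy unfolding w(1) by simp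
    have "(P\<^sup>T * P) $$ (x, y) = (\<Sum>l<n. p l x * p l y)"
      using w(4-7) xy by (simp add: scalar_prod_def lessThan_atLeast0 p_def)
    then show "(\<Sum>l<n. p l x * p l y) = (if x = y then 1 else 0)" using xy unfolding w(2) by simp
    have PD: "(P * D) $$ (x, l) = lam l * p x l" if "l < n" for l
    proof -
      have "(P * D) $$ (x, l) = (\<Sum>k<n. p x k * D $$ (k, l))"
        using w xy that by (simp add: scalar_prod_def lessThan_atLeast0 p_def)
      also have "\<dots> = (\<Sum>k<n. if k = l then p x l * lam l else 0)"
        by (rule sum.cong) (use D0 that in \<open>auto simp: lam_def\<close>)
      finally show ?thesis using that by simp
    qed
    have "A $$ (x, y) = (\<Sum>l<n. (P * D) $$ (x, l) * p y l)"
      using w(4-7) xy by (subst w(3)) (simp del: assoc_mult_mat add: scalar_prod_def lessThan_atLeast0 p_def)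
    then show "A $$ (x, y) = (\<Sum>l<n. lam l * p x l * p y l)" by (simp add: PD)
  next
    show "spectrum A = lam ` {..<n}"
      by (auto simp: spectrum_root_char_poly[OF A] cp poly_prod_list prod_list_zero_iff)
    show "Polynomial.order b (char_poly A) = card {l. l < n \<and> lam l = b}" for b
      unfolding cp order_linear_prod_list
      by (simp add: length_filter_map length_filter_conv_card cong: conj_cong)
  qed
qed

section \<open>Orthogonal families of functions\<close>

text \<open>\<open>c i\<close> is the squared norm of the \<open>i\<close>-th member; its positivity
  excludes zero members. The base set is arbitrary because vertices, matrix indices and eigenvector
  indices all occur in this role.\<close>

definition orthogonal_family :: "'b set \<Rightarrow> 'i set \<Rightarrow> ('i \<Rightarrow> real) \<Rightarrow> ('i \<Rightarrow> 'b \<Rightarrow> real) \<Rightarrow> bool" where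
  "orthogonal_family V I c f \<longleftrightarrow>
     (\<forall>i\<in>I. c i > 0 \<and> (\<forall>j\<in>I. (\<Sum>x\<in>V. f i x * f j x) = (if i = j then c i else 0)))"

lemma orthogonal_familyD:
  assumes "orthogonal_family V I c f" "i \<in> I"
  shows "c i > 0" and "c i \<noteq> 0" and "j \<in> I \<Longrightarrow> (\<Sum>x\<in>V. f i x * f j x) = (if i = j then c i else 0)"
proof -
  show "c i > 0" and "j \<in> I \<Longrightarrow> (\<Sum>x\<in>V. f i x * f j x) = (if i = j then c i else 0)"
    using assms by (auto simp: orthogonal_family_def)
  then show "c i \<noteq> 0" by simp
qed

text \<open>The unit vector at \<open>l\<close> projected onto the orthogonal complement of the
  family, that is, row \<open>l\<close> of the projection matrix.\<close>

definition point_residual :: "'i set \<Rightarrow> ('i \<Rightarrow> real) \<Rightarrow> ('i \<Rightarrow> 'b \<Rightarrow> real) \<Rightarrow> 'b \<Rightarrow> 'b \<Rightarrow> real" where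
  "point_residual I c f l x = (if l = x then 1 else 0) - (\<Sum>i\<in>I. f i l * f i x / c i)"

section \<open>Projection onto the complement of an orthogonal family\<close>

context
  fixes V :: "'b set" and I :: "'i set" and c :: "'i \<Rightarrow> real" and f :: "'i \<Rightarrow> 'b \<Rightarrow> real"
  assumes finV: "finite V" and finI: "finite I" and orth: "orthogonal_family V I c f"
begin

lemma point_residual_orthogonal:
  assumes j: "j \<in> I" and l: "l \<in> V"
  shows "(\<Sum>x\<in>V. point_residual I c f l x * f j x) = 0"
proof -
  have "(\<Sum>x\<in>V. point_residual I c f l x * f j x)
      = (\<Sum>x\<in>V. (if l = x then f j x else 0) - (\<Sum>i\<in>I. f i l / c i * (f i x * f j x)))"
    by (rule sum.cong) (auto simp: point_residual_def left_diff_distrib sum_distrib_right mult.assoc)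
  also have "\<dots> = f j l - (\<Sum>x\<in>V. \<Sum>i\<in>I. f i l / c i * (f i x * f j x))"
    using l finV by (simp add: sum_subtractf)
  also have "(\<Sum>x\<in>V. \<Sum>i\<in>I. f i l / c i * (f i x * f j x))
      = (\<Sum>i\<in>I. f i l / c i * (\<Sum>x\<in>V. f i x * f j x))"
    by (subst sum.swap) (simp add: sum_distrib_left)
  also have "\<dots> = (\<Sum>i\<in>I. if i = j then f j l else 0)"
    using j by (intro sum.cong) (simp_all add: orthogonal_familyD(2,3)[OF orth])
  also have "\<dots> = f j l" using j finI by simp
  finally show ?thesis by simp
qed

text \<open>Pythagoras: when one factor of the square is expanded, its part in the span of the
  family is orthogonal to the residual, so only the entry at \<open>l\<close> survives.\<close>

lemma point_residual_norm:
  assumes l: "l \<in> V"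
  shows "(\<Sum>x\<in>V. (point_residual I c f l x)\<^sup>2) = 1 - (\<Sum>i\<in>I. (f i l)\<^sup>2 / c i)"
proof -
  have "(\<Sum>x\<in>V. (point_residual I c f l x)\<^sup>2)
      = (\<Sum>x\<in>V. (if l = x then point_residual I c f l x else 0)
          - (\<Sum>i\<in>I. f i l / c i * (point_residual I c f l x * f i x)))"
  proof (rule sum.cong)
    fix x
    have "(point_residual I c f l x)\<^sup>2 = point_residual I c f l x
        * ((if l = x then 1 else 0) - (\<Sum>i\<in>I. f i l * f i x / c i))"
      by (simp add: power2_eq_square point_residual_def)
    then show "(point_residual I c f l x)\<^sup>2 = (if l = x then point_residual I c f l x else 0)
          - (\<Sum>i\<in>I. f i l / c i * (point_residual I c f l x * f i x))"
      by (simp add: right_diff_distrib sum_distrib_left mult_ac)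
  qed simp
  also have "\<dots> = point_residual I c f l l
      - (\<Sum>x\<in>V. \<Sum>i\<in>I. f i l / c i * (point_residual I c f l x * f i x))"
    using l finV by (simp add: sum_subtractf)
  also have "(\<Sum>x\<in>V. \<Sum>i\<in>I. f i l / c i * (point_residual I c f l x * f i x))
      = (\<Sum>i\<in>I. f i l / c i * (\<Sum>x\<in>V. point_residual I c f l x * f i x))"
    by (subst sum.swap) (simp add: sum_distrib_left)
  also have "\<dots> = 0" using l by (simp add: point_residual_orthogonal)
  finally show ?thesis by (simp add: point_residual_def power2_eq_square)
qed

text \<open>This is the trace of the projection onto the complement. Being nonnegative it bounds the
  size of the family, when zero it forces completeness, and when nonzero it supplies a further
  orthogonal vector.\<close>

lemma point_residual_sum_norms:
  "(\<Sum>l\<in>V. \<Sum>x\<in>V. (point_residual I c f l x)\<^sup>2) = real (card V) - real (card I)"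
proof -
  have "(\<Sum>l\<in>V. \<Sum>i\<in>I. (f i l)\<^sup>2 / c i) = (\<Sum>i\<in>I. (\<Sum>l\<in>V. f i l * f i l) / c i)"
    by (subst sum.swap) (simp add: sum_divide_distrib power2_eq_square)
  also have "\<dots> = (\<Sum>i\<in>I. 1)"
    by (rule sum.cong) (simp_all add: orthogonal_familyD(2,3)[OF orth])
  finally show ?thesis by (simp add: point_residual_norm sum_subtractf)
qed

lemma orthogonal_family_card_le: "card I \<le> card V"
proof -
  have "0 \<le> (\<Sum>l\<in>V. \<Sum>x\<in>V. (point_residual I c f l x)\<^sup>2)" by (intro sum_nonneg) auto
  then show ?thesis by (simp add: point_residual_sum_norms)
qed

lemma orthogonal_family_complete:
  assumes "card I = card V" "l \<in> V" "x \<in> V"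
  shows "(\<Sum>i\<in>I. f i l * f i x / c i) = (if l = x then 1 else 0)"
proof -
  have "(\<Sum>l\<in>V. \<Sum>x\<in>V. (point_residual I c f l x)\<^sup>2) = 0"
    using assms by (simp add: point_residual_sum_norms)
  then have "point_residual I c f l x = 0"
    using assms finV by (simp add: sum_nonneg_eq_0_iff sum_nonneg)
  then show ?thesis by (simp add: point_residual_def)
qed

lemma orthogonal_family_extend:
  assumes "card I < card V"
  obtains r where "\<exists>x\<in>V. r x \<noteq> 0" "\<And>i. i \<in> I \<Longrightarrow> (\<Sum>x\<in>V. f i x * r x) = 0"
proof -
  have "(\<Sum>l\<in>V. \<Sum>x\<in>V. (point_residual I c f l x)\<^sup>2) \<noteq> 0"
    using assms by (simp add: point_residual_sum_norms)
  then obtain l where l: "l \<in> V" and "(\<Sum>x\<in>V. (point_residual I c f l x)\<^sup>2) \<noteq> 0"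
    by (metis (no_types, lifting) sum.neutral)
  then obtain x where "x \<in> V" "(point_residual I c f l x)\<^sup>2 \<noteq> 0"
    by (metis (no_types, lifting) sum.neutral)
  with l show thesis
    by (intro that[of "point_residual I c f l"]) (auto simp: point_residual_orthogonal mult.commute[of "f _ _"])
qed

end

section \<open>Plane rotations inside an orthogonal family\<close>

definition rotate_pair :: "real \<Rightarrow> 'i \<Rightarrow> 'i \<Rightarrow> ('i \<Rightarrow> 'b \<Rightarrow> real) \<Rightarrow> 'i \<Rightarrow> 'b \<Rightarrow> real" where
  "rotate_pair t i j f = (\<lambda>k x.
     if k = i then (f i x + t * f j x) / sqrt (1 + t\<^sup>2)
     else if k = j then (f j x - t * f i x) / sqrt (1 + t\<^sup>2)
     else f k x)"

lemma sqrt_1_plus_square_mult: "sqrt (1 + t\<^sup>2) * sqrt (1 + t\<^sup>2) = 1 + (t::real)\<^sup>2"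
  by simp

text \<open>The rotation is an orthogonal matrix acting on the index set, hence preserves inner
  products taken over the indices. Its parameter \<open>t\<close> is the tangent of the angle, so
  that the vanishing of a new entry is a linear equation in \<open>t\<close>.\<close>

lemma rotate_pair_gram:
  assumes "finite I" "i \<in> I" "j \<in> I" "i \<noteq> j"
  shows "(\<Sum>k\<in>I. rotate_pair t i j f k x * rotate_pair t i j f k y) = (\<Sum>k\<in>I. f k x * f k y)"
proof -
  have nz: "1 + t\<^sup>2 \<noteq> 0" by (metis add_pos_nonneg less_numeral_extra(1,3) zero_le_power2)
  have split: "sum h I = h i + h j + sum h (I - {i, j})" for h :: "'a \<Rightarrow> real"
  proof -
    have "sum h I = sum h {i, j} + sum h (I - {i, j})"
      using assms by (metis Diff_subset add.commute insert_subset empty_subsetI sum.subset_diff)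
    then show ?thesis using assms by simp
  qed
  have "rotate_pair t i j f i x * rotate_pair t i j f i y + rotate_pair t i j f j x * rotate_pair t i j f j y
      = ((f i x + t * f j x) * (f i y + t * f j y) + (f j x - t * f i x) * (f j y - t * f i y)) / (1 + t\<^sup>2)"
    using assms
    by (simp add: rotate_pair_def times_divide_times_eq sqrt_1_plus_square_mult
        add_divide_distrib[of _ _ "1 + t\<^sup>2"] del: times_divide_eq_left times_divide_eq_right)
  also have "\<dots> = (f i x * f i y + f j x * f j y) * (1 + t\<^sup>2) / (1 + t\<^sup>2)"
    by (rule arg_cong[where f = "\<lambda>a. a / (1 + t\<^sup>2)"]) (simp add: algebra_simps power2_eq_square)
  also have "\<dots> = f i x * f i y + f j x * f j y" using nz by simp
  finally have "rotate_pair t i j f i x * rotate_pair t i j f i y + rotate_pair t i j f j x * rotate_pair t i j f j y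
      = f i x * f i y + f j x * f j y" .
  moreover have "(\<Sum>k\<in>I - {i, j}. rotate_pair t i j f k x * rotate_pair t i j f k y) = (\<Sum>k\<in>I - {i, j}. f k x * f k y)"
    by (rule sum.cong) (auto simp: rotate_pair_def)
  ultimately show ?thesis by (simp add: split)
qed

text \<open>The product of the two new members is \<open>t * (c j - c i) / (1 + t\<^sup>2)\<close>;
  this is where equal norms enter.\<close>

lemma rotate_pair_orthogonal_family:
  assumes orth: "orthogonal_family V I c f" and ij: "i \<in> I" "j \<in> I" "i \<noteq> j" "c i = c j"
  shows "orthogonal_family V I c (rotate_pair t i j f)"
proof -
  define ip where "ip g h = (\<Sum>x\<in>V. g x * h x)" for g h :: "'a \<Rightarrow> real"
  define s where "s = sqrt (1 + t\<^sup>2)"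
  have nz: "1 + t\<^sup>2 \<noteq> 0" by (metis add_pos_nonneg less_numeral_extra(1,3) zero_le_power2)
  have s: "s * s = 1 + t\<^sup>2" by (simp add: s_def sqrt_1_plus_square_mult)
  have comm: "ip g h = ip h g" for g h by (simp add: ip_def mult.commute)
  have lin: "ip (\<lambda>x. (g x + a * g' x) / s) h = (ip g h + a * ip g' h) / s" for g g' h a
  proof -
    have "ip (\<lambda>x. (g x + a * g' x) / s) h = (\<Sum>x\<in>V. (g x * h x) / s + a * (g' x * h x) / s)"
      unfolding ip_def by (rule sum.cong) (simp_all add: add_divide_distrib distrib_right mult.assoc)
    then show ?thesis
      by (simp add: ip_def sum.distrib sum_divide_distrib sum_distrib_left add_divide_distrib)
  qed
  have lin': "ip (\<lambda>x. (g x - a * g' x) / s) h = (ip g h - a * ip g' h) / s" for g g' h a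
    using lin[of g "-a" g' h] by simp
  have o: "ip (f k) (f l) = (if k = l then c k else 0)" if "k \<in> I" "l \<in> I" for k l
    using orthogonal_familyD(3)[OF orth that] by (simp add: ip_def)
  let ?r = "rotate_pair t i j f"
  have ri: "?r i = (\<lambda>x. (f i x + t * f j x) / s)" and rj: "?r j = (\<lambda>x. (f j x - t * f i x) / s)"
    using ij by (auto simp: rotate_pair_def s_def)
  have rk: "?r k = f k" if "k \<noteq> i" "k \<noteq> j" for k
    using that by (auto simp: rotate_pair_def)
  have i: "ip (?r i) h = (ip (f i) h + t * ip (f j) h) / s" for h by (simp add: ri lin)
  have j: "ip (?r j) h = (ip (f j) h - t * ip (f i) h) / s" for h by (simp add: rj lin')
  have i': "ip h (?r i) = (ip (f i) h + t * ip (f j) h) / s" for h by (simp add: comm[of h] i)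
  have j': "ip h (?r j) = (ip (f j) h - t * ip (f i) h) / s" for h by (simp add: comm[of h] j)
  have cs: "(a + t * (t * a)) / (s * s) = a" for a
    using nz unfolding s by (simp add: field_simps power2_eq_square)
  have "ip (?r k) (?r l) = (if k = l then c k else 0)" if "k \<in> I" "l \<in> I" for k l
  proof -
    consider "k = i" | "k = j" | "k \<noteq> i" "k \<noteq> j" by blast
    then show ?thesis
    proof cases
      case 1
      consider "l = i" | "l = j" | "l \<noteq> i" "l \<noteq> j" by blast
      then show ?thesis
        by cases (use 1 ij that cs[of "c j"] in \<open>auto simp: i j i' j' o rk add_divide_distrib\<close>)
    next
      case 2
      consider "l = i" | "l = j" | "l \<noteq> i" "l \<noteq> j" by blast
      then show ?thesis
        by cases (use 2 ij that cs[of "c j"] in \<open>auto simp: i j i' j' o rk add_divide_distrib\<close>)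
    next
      case 3
      consider "l = i" | "l = j" | "l \<noteq> i" "l \<noteq> j" by blast
      then show ?thesis
        by cases (use 3 ij that in \<open>auto simp: i j i' j' o rk\<close>)
    qed
  qed
  then show ?thesis
    using orthogonal_familyD(1)[OF orth] by (auto simp: orthogonal_family_def ip_def)
qed

text \<open>
  Rotating two members of equal norm through a generic angle removes a zero entry of one of them
  where the other does not vanish, and creates no new zero.  So a family with the fewest zero
  entries has none.
\<close>
lemma orthogonal_family_nowhere_zero:
  fixes f :: "'i \<Rightarrow> 'b \<Rightarrow> real"
  assumes finV: "finite V" and finI: "finite I" and f: "orthogonal_family V I c f"
    and partner: "\<And>g i v. orthogonal_family V I c g \<Longrightarrow>
      (\<And>u v. (\<Sum>k\<in>I. g k u * g k v) = (\<Sum>k\<in>I. f k u * f k v)) \<Longrightarrow>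
      i \<in> I \<Longrightarrow> v \<in> V \<Longrightarrow> \<exists>j\<in>I. c j = c i \<and> g j v \<noteq> 0"
  obtains g where "orthogonal_family V I c g"
    "\<And>u v. (\<Sum>k\<in>I. g k u * g k v) = (\<Sum>k\<in>I. f k u * f k v)"
    "\<And>i v. i \<in> I \<Longrightarrow> v \<in> V \<Longrightarrow> g i v \<noteq> 0"
proof -
  define P where "P g \<longleftrightarrow> orthogonal_family V I c g \<and>
    (\<forall>u v. (\<Sum>k\<in>I. g k u * g k v) = (\<Sum>k\<in>I. f k u * f k v))" for g
  define Zs where "Zs g = {(i, v). i \<in> I \<and> v \<in> V \<and> g i v = 0}" for g :: "'i \<Rightarrow> 'b \<Rightarrow> real"
  have finZ: "finite (Zs g)" for g
    by (rule finite_subset[of _ "I \<times> V"]) (use finI finV in \<open>auto simp: Zs_def\<close>)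
  have "P f" using f by (simp add: P_def)
  then obtain g where g: "P g" and least: "\<And>h. P h \<Longrightarrow> card (Zs g) \<le> card (Zs h)"
    using exists_least_iff[of "\<lambda>m. \<exists>h. P h \<and> card (Zs h) = m"] by (metis linorder_not_le)
  have "g i v \<noteq> 0" if iv: "i \<in> I" "v \<in> V" for i v
  proof
    assume 0: "g i v = 0"
    obtain j where j: "j \<in> I" "c j = c i" "g j v \<noteq> 0"
      using partner[of g i v] g iv unfolding P_def by blast
    have ij: "i \<noteq> j" using 0 j by auto
    \<comment> \<open>The finitely many solutions \<open>t\<close> of
      \<open>g i u + t * g j u = 0\<close> or \<open>g j u - t * g i u = 0\<close>; a zero
      denominator only contributes the value 0.\<close>
    define Bad where "Bad = {0} \<union> (\<lambda>u. - g i u / g j u) ` V \<union> (\<lambda>u. g j u / g i u) ` V"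
    have "finite Bad" using finV by (simp add: Bad_def)
    from ex_new_if_finite[OF infinite_UNIV_char_0 this] obtain t where t: "t \<notin> Bad" by blast
    let ?h = "rotate_pair t i j g"
    have "P ?h"
      using g rotate_pair_orthogonal_family[of V I c g i j t] rotate_pair_gram[OF finI iv(1) j(1) ij, of t g]
        iv j ij by (simp add: P_def)
    have s: "sqrt (1 + t\<^sup>2) \<noteq> 0" by (metis add_pos_nonneg less_numeral_extra(1,3) real_sqrt_eq_zero_cancel_iff zero_le_power2)
    have 1: "g i u + t * g j u \<noteq> 0" if "u \<in> V" "g i u \<noteq> 0 \<or> g j u \<noteq> 0" for u
    proof
      assume e: "g i u + t * g j u = 0"
      then have "g j u \<noteq> 0" using that by auto
      with e have "t = - g i u / g j u" by (simp add: field_simps)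
      then show False using t that unfolding Bad_def by blast
    qed
    have 2: "g j u - t * g i u \<noteq> 0" if "u \<in> V" "g j u \<noteq> 0" for u
    proof
      assume e: "g j u - t * g i u = 0"
      then have "g i u \<noteq> 0" using that by auto
      with e have "t = g j u / g i u" by (simp add: field_simps)
      then show False using t that unfolding Bad_def by blast
    qed
    \<comment> \<open>A new entry of member \<open>i\<close> vanishes only where both old ones do,
      one of member \<open>j\<close> only where \<open>g j\<close> does. The zero at
      \<open>(i, v)\<close> disappears because \<open>g j v\<close> is nonzero.\<close>
    have "Zs ?h \<subseteq> Zs g"
      using 1 2 s by (auto simp: Zs_def rotate_pair_def split: if_splits)
    moreover have "(i, v) \<in> Zs g" "(i, v) \<notin> Zs ?h"
      using iv 0 j 1[of v] s by (auto simp: Zs_def rotate_pair_def)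
    ultimately have "Zs ?h \<subset> Zs g" by blast
    then have "card (Zs ?h) < card (Zs g)" by (rule psubset_card_mono[OF finZ])
    with least[OF \<open>P ?h\<close>] show False by simp
  qed
  with g show thesis by (intro that[of g]) (auto simp: P_def)
qed

section \<open>Spectra of symmetric matrices and of Gram matrices\<close>

lemma eigenvalueI_sum:
  fixes A :: "real mat"
  assumes A: "A \<in> carrier_mat n n" and nz: "\<exists>x<n. v x \<noteq> 0"
    and ev: "\<And>x. x < n \<Longrightarrow> (\<Sum>y<n. A $$ (x, y) * v y) = e * v x"
  shows "e \<in> spectrum A"
proof -
  have "A *\<^sub>v vec n v = e \<cdot>\<^sub>v vec n v"
    by (rule eq_vecI) (use A ev in \<open>auto simp: scalar_prod_def lessThan_atLeast0\<close>)
  moreover have "vec n v \<noteq> 0\<^sub>v n" using nz by (metis index_vec index_zero_vec(1))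
  ultimately show ?thesis using A
    by (auto simp: spectrum_def eigenvalue_def eigenvector_def intro!: exI[of _ "vec n v"])
qed

text \<open>With a single eigenvalue \<open>a\<close>, the spectral decomposition collapses to
  \<open>a\<close> times the identity.\<close>

lemma symmetric_offdiagonal_card_spectrum:
  fixes A :: "real mat"
  assumes A: "A \<in> carrier_mat n n" "A\<^sup>T = A" and ij: "i < n" "j < n" "i \<noteq> j" "A $$ (i, j) \<noteq> 0"
  shows "2 \<le> card (spectrum A)"
proof (rule ccontr)
  assume *: "\<not> 2 \<le> card (spectrum A)"
  obtain lam p where p: "\<And>x y. x < n \<Longrightarrow> y < n \<Longrightarrow> (\<Sum>l<n. p x l * p y l) = (if x = y then 1 else 0)"
    and dec: "\<And>x y. x < n \<Longrightarrow> y < n \<Longrightarrow> A $$ (x, y) = (\<Sum>l<n. lam l * p x l * p y l)"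
    and spec: "spectrum A = lam ` {..<n}"
    by (rule real_symmetric_spectral_decomposition[OF A]) blast
  have "finite (spectrum A)" "spectrum A \<noteq> {}" using spec ij by auto
  with * have "card (spectrum A) = 1" by (metis One_nat_def card_eq_0_iff less_2_cases linorder_not_le)
  then obtain a where "spectrum A = {a}" by (auto simp: card_1_singleton_iff)
  then have "lam l = a" if "l < n" for l using spec that by auto
  then have "A $$ (i, j) = a * (\<Sum>l<n. p i l * p j l)"
    using dec[OF ij(1,2)] by (simp add: sum_distrib_left mult_ac)
  with ij show False by (simp add: p)
qed

text \<open>The Gram vector of \<open>i\<close> is the row \<open>p i\<close> restricted to the
  positions \<open>L\<close> of the eigenvalue \<open>b\<close>. Independence makes these vectors
  orthogonal, a neighbour makes each nonzero, and there is room for at most \<open>card L\<close> of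
  them.\<close>

lemma symmetric_independent_card_le_multiplicity:
  fixes A :: "real mat"
  assumes A: "A \<in> carrier_mat n n" "A\<^sup>T = A" and spec: "spectrum A = {a, b}" "a \<noteq> b"
    and S: "S \<subseteq> {..<n}"
    and indep: "\<And>i j. i \<in> S \<Longrightarrow> j \<in> S \<Longrightarrow> i \<noteq> j \<Longrightarrow> A $$ (i, j) = 0"
    and nbr: "\<And>i. i \<in> S \<Longrightarrow> \<exists>j<n. j \<noteq> i \<and> A $$ (i, j) \<noteq> 0"
  shows "card S \<le> Polynomial.order b (char_poly A)"
proof -
  obtain lam p where p: "\<And>x y. x < n \<Longrightarrow> y < n \<Longrightarrow> (\<Sum>l<n. p x l * p y l) = (if x = y then 1 else 0)"
    and dec: "\<And>x y. x < n \<Longrightarrow> y < n \<Longrightarrow> A $$ (x, y) = (\<Sum>l<n. lam l * p x l * p y l)"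
    and lam: "spectrum A = lam ` {..<n}"
    and ord: "\<And>b. Polynomial.order b (char_poly A) = card {l. l < n \<and> lam l = b}"
    by (rule real_symmetric_spectral_decomposition[OF A]) blast
  define L where "L = {l. l < n \<and> lam l = b}"
  have finL: "finite L" by (simp add: L_def)
  have finS: "finite S" using S finite_subset by blast
  have ab: "lam l = a \<or> lam l = b" if "l < n" for l using lam spec that by auto
  \<comment> \<open>Subtracting \<open>a\<close> times the identity changes no off-diagonal entry
    and removes all terms with eigenvalue \<open>a\<close>.\<close>
  have key: "A $$ (i, j) = (b - a) * (\<Sum>l\<in>L. p i l * p j l)" if "i < n" "j < n" "i \<noteq> j" for i j
  proof -
    have "A $$ (i, j) = (\<Sum>l<n. lam l * p i l * p j l) - a * (\<Sum>l<n. p i l * p j l)"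
      using that by (simp add: dec p)
    also have "\<dots> = (\<Sum>l<n. (lam l - a) * (p i l * p j l))"
      by (simp add: sum_distrib_left sum_subtractf algebra_simps)
    also have "\<dots> = (\<Sum>l\<in>L. (lam l - a) * (p i l * p j l))"
      by (rule sum.mono_neutral_right) (use ab in \<open>auto simp: L_def\<close>)
    also have "\<dots> = (b - a) * (\<Sum>l\<in>L. p i l * p j l)"
      by (simp add: sum_distrib_left L_def)
    finally show ?thesis .
  qed
  have "orthogonal_family L S (\<lambda>i. \<Sum>l\<in>L. p i l * p i l) p"
    unfolding orthogonal_family_def
  proof (intro ballI conjI)
    fix i assume i: "i \<in> S"
    obtain j where j: "j < n" "j \<noteq> i" "A $$ (i, j) \<noteq> 0" using nbr[OF i] by blast
    have "(\<Sum>l\<in>L. p i l * p j l) \<noteq> 0" using key[of i j] i j S by auto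
    then obtain l where "l \<in> L" "p i l \<noteq> 0" by (metis (no_types, lifting) mult_zero_left sum.neutral)
    then show "0 < (\<Sum>l\<in>L. p i l * p i l)" using finL
      by (intro sum_pos2[of L l]) (auto simp: zero_less_mult_iff)
    fix j assume j: "j \<in> S"
    show "(\<Sum>l\<in>L. p i l * p j l) = (if i = j then \<Sum>l\<in>L. p i l * p i l else 0)"
      using key[of i j] indep[of i j] i j S spec(2) by auto
  qed
  from orthogonal_family_card_le[OF finL finS this] show ?thesis by (simp add: ord L_def)
qed

section \<open>Gram matrices of orthogonal families\<close>

context
  fixes A :: "real mat" and n :: nat and I :: "'i set" and c :: "'i \<Rightarrow> real" and f :: "'i \<Rightarrow> nat \<Rightarrow> real"
  assumes A: "A \<in> carrier_mat n n" and finI: "finite I"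
    and gram: "\<And>x y. x < n \<Longrightarrow> y < n \<Longrightarrow> A $$ (x, y) = (\<Sum>k\<in>I. f k x * f k y)"
    and orth: "orthogonal_family {..<n} I c f"
begin

lemma gram_mult_eq:
  assumes "x < n"
  shows "(\<Sum>y<n. A $$ (x, y) * v y) = (\<Sum>k\<in>I. f k x * (\<Sum>y<n. f k y * v y))"
proof -
  have "(\<Sum>y<n. A $$ (x, y) * v y) = (\<Sum>y<n. \<Sum>k\<in>I. f k x * (f k y * v y))"
    using assms by (intro sum.cong) (simp_all add: gram sum_distrib_right mult.assoc)
  also have "\<dots> = (\<Sum>k\<in>I. f k x * (\<Sum>y<n. f k y * v y))"
    by (subst sum.swap) (simp add: sum_distrib_left)
  finally show ?thesis .
qed

lemma gram_mult_member:
  assumes "x < n" "i \<in> I"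
  shows "(\<Sum>y<n. A $$ (x, y) * f i y) = c i * f i x"
proof -
  have "(\<Sum>k\<in>I. f k x * (\<Sum>y<n. f k y * f i y)) = (\<Sum>k\<in>I. if k = i then c i * f i x else 0)"
    by (rule sum.cong) (use orthogonal_familyD(3)[OF orth _ assms(2)] in simp_all)
  then show ?thesis using assms finI by (simp add: gram_mult_eq)
qed

text \<open>By orthogonality, each member is an eigenvector of the Gram matrix with its own squared
  norm as eigenvalue.\<close>

lemma gram_norm_in_spectrum:
  assumes i: "i \<in> I"
  shows "c i \<in> spectrum A"
proof (rule eigenvalueI_sum[OF A _ gram_mult_member])
  have "(\<Sum>x<n. f i x * f i x) \<noteq> 0" using orthogonal_familyD[OF orth i] i by force
  then show "\<exists>x<n. f i x \<noteq> 0" by (metis (no_types, lifting) lessThan_iff mult_zero_left sum.neutral)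
qed (use i in auto)

text \<open>For reasons of dimension some nonzero vector is orthogonal to the whole family; it lies
  in the kernel.\<close>

lemma gram_zero_in_spectrum:
  assumes "card I < n"
  shows "0 \<in> spectrum A"
proof -
  obtain r where "\<exists>x\<in>{..<n}. r x \<noteq> 0" "\<And>i. i \<in> I \<Longrightarrow> (\<Sum>x<n. f i x * r x) = 0"
    using orthogonal_family_extend[OF _ finI orth] assms by auto
  then show ?thesis by (intro eigenvalueI_sum[OF A, of r]) (auto simp: gram_mult_eq)
qed

text \<open>An eigenvector orthogonal to all members has eigenvalue 0, any other has eigenvalue
  \<open>e\<close>. The trace then determines the multiplicity of \<open>e\<close>.\<close>

lemma gram_constant_norm_spectrum:
  assumes const: "\<And>i. i \<in> I \<Longrightarrow> c i = e" and "I \<noteq> {}" "card I < n"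
  shows "spectrum A = {0, e}" "Polynomial.order 0 (char_poly A) = n - card I"
    "Polynomial.order e (char_poly A) = card I"
proof -
  obtain i where i: "i \<in> I" using \<open>I \<noteq> {}\<close> by blast
  then have e: "e > 0" using orthogonal_familyD(1)[OF orth i] const by simp
  have Asym: "A $$ (x, y) = A $$ (y, x)" if "x < n" "y < n" for x y
    using that by (simp add: gram mult.commute)
  have "A\<^sup>T = A" by (rule eq_matI) (use A Asym in auto)
  then obtain lam p where
      p: "\<And>x y. x < n \<Longrightarrow> y < n \<Longrightarrow> (\<Sum>l<n. p x l * p y l) = (if x = y then 1 else 0)"
    and p': "\<And>l m. l < n \<Longrightarrow> m < n \<Longrightarrow> (\<Sum>x<n. p x l * p x m) = (if l = m then 1 else 0)"
    and dec: "\<And>x y. x < n \<Longrightarrow> y < n \<Longrightarrow> A $$ (x, y) = (\<Sum>l<n. lam l * p x l * p y l)"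
    and lam: "spectrum A = lam ` {..<n}"
    and ord: "\<And>b. Polynomial.order b (char_poly A) = card {l. l < n \<and> lam l = b}"
    by (rule real_symmetric_spectral_decomposition[OF A]) blast
  have lam0e: "lam m = 0 \<or> lam m = e" if m: "m < n" for m
  proof -
    have ev: "(\<Sum>y<n. A $$ (x, y) * p y m) = lam m * p x m" if "x < n" for x
    proof -
      have "(\<Sum>y<n. A $$ (x, y) * p y m) = (\<Sum>y<n. \<Sum>l<n. lam l * p x l * (p y l * p y m))"
        using that by (intro sum.cong) (simp_all add: dec sum_distrib_right mult.assoc)
      also have "\<dots> = (\<Sum>l<n. lam l * p x l * (\<Sum>y<n. p y l * p y m))"
        by (subst sum.swap) (simp add: sum_distrib_left)
      also have "\<dots> = (\<Sum>l<n. if l = m then lam m * p x m else 0)"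
        by (rule sum.cong) (use p' m in auto)
      finally show ?thesis using m by simp
    qed
    define a where "a k = (\<Sum>y<n. f k y * p y m)" for k
    \<comment> \<open>Pair the eigenvector equation with \<open>f k\<close> and move
      \<open>A\<close> to the other side by symmetry, where \<open>f k\<close> is an eigenvector for
      \<open>e\<close>.\<close>
    have a: "e * a k = lam m * a k" if k: "k \<in> I" for k
    proof -
      have "lam m * a k = (\<Sum>x<n. f k x * (lam m * p x m))"
        by (simp add: a_def sum_distrib_left mult_ac)
      also have "\<dots> = (\<Sum>x<n. f k x * (\<Sum>y<n. A $$ (x, y) * p y m))"
        by (rule sum.cong) (simp_all add: ev)
      also have "\<dots> = (\<Sum>y<n. \<Sum>x<n. f k x * (A $$ (x, y) * p y m))"
        unfolding sum_distrib_left by (rule sum.swap)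
      also have "\<dots> = (\<Sum>y<n. (\<Sum>x<n. A $$ (y, x) * f k x) * p y m)"
        unfolding sum_distrib_right
        by (intro sum.cong refl) (simp add: Asym mult_ac)
      also have "\<dots> = (\<Sum>y<n. e * f k y * p y m)"
        using k by (intro sum.cong) (simp_all add: gram_mult_member const)
      also have "\<dots> = e * a k" by (simp add: a_def sum_distrib_left mult.assoc)
      finally show ?thesis by (rule sym)
    qed
    obtain x where x: "x < n" "p x m \<noteq> 0"
      using p'[OF m m] by (metis (no_types, lifting) lessThan_iff mult_zero_left sum.neutral zero_neq_one)
    show ?thesis
    proof (cases "\<exists>k\<in>I. a k \<noteq> 0")
      case True then show ?thesis using a by auto
    next
      case False
      then have "lam m * p x m = 0"
        using ev[OF x(1)] gram_mult_eq[OF x(1), of "\<lambda>y. p y m"] by (simp add: a_def)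
      then show ?thesis using x by simp
    qed
  qed
  define L where "L b = {l. l < n \<and> lam l = b}" for b
  have fin: "finite (L b)" for b by (simp add: L_def)
  \<comment> \<open>The trace computed twice: as the sum of the eigenvalues and as the sum of the
    squared norms of the members.\<close>
  have "(\<Sum>x<n. A $$ (x, x)) = (\<Sum>x<n. \<Sum>l<n. lam l * (p x l * p x l))"
    by (simp add: dec mult.assoc)
  also have "\<dots> = (\<Sum>l<n. lam l * (\<Sum>x<n. p x l * p x l))"
    by (subst sum.swap) (simp add: sum_distrib_left)
  also have "\<dots> = (\<Sum>l<n. lam l)" by (simp add: p')
  also have "\<dots> = (\<Sum>l\<in>L e. lam l)"
    by (rule sum.mono_neutral_right) (use lam0e in \<open>auto simp: L_def\<close>)
  also have "\<dots> = e * real (card (L e))" by (simp add: L_def)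
  finally have "(\<Sum>x<n. A $$ (x, x)) = e * real (card (L e))" .
  moreover have "(\<Sum>x<n. A $$ (x, x)) = (\<Sum>k\<in>I. \<Sum>x<n. f k x * f k x)"
    by (subst sum.swap) (simp add: gram)
  moreover have "\<dots> = (\<Sum>k\<in>I. e)"
    by (rule sum.cong) (simp_all add: orthogonal_familyD(3)[OF orth] const)
  ultimately have cardL: "card (L e) = card I" using e by simp
  have "L 0 \<union> L e = {..<n}" "L 0 \<inter> L e = {}" using lam0e e by (auto simp: L_def)
  then have "card (L 0) + card (L e) = n" using fin by (metis card_Un_disjoint card_lessThan)
  then show "Polynomial.order 0 (char_poly A) = n - card I"
    "Polynomial.order e (char_poly A) = card I"
    using cardL by (auto simp: ord L_def)
  show "spectrum A = {0, e}"
    using lam lam0e gram_norm_in_spectrum[OF i] const[OF i] gram_zero_in_spectrum \<open>card I < n\<close> by auto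
qed

end

section \<open>Two distinct eigenvalues\<close>

lemma sum_nth_distinct:
  assumes "distinct vs" "set vs = V"
  shows "(\<Sum>x<length vs. h (vs ! x)) = sum h V"
  using sum.reindex_bij_betw[OF bij_betw_nth[OF assms(1) refl assms(2)[symmetric]]] by simp

lemma matrices_of_edge_q_mat:
  assumes "A \<in> \<S> G" "u \<in> pverts G" "v \<in> pverts G" "u \<noteq> v" "(u, v) \<in> parcs G"
  shows "2 \<le> q_mat A"
proof -
  obtain vs where vs: "distinct vs" "set vs = pverts G" "A \<in> carrier_mat (length vs) (length vs)" "A\<^sup>T = A"
    and adj: "\<And>i j. i < length vs \<Longrightarrow> j < length vs \<Longrightarrow> i \<noteq> j \<Longrightarrow> (A $$ (i, j) \<noteq> 0 \<longleftrightarrow> (vs ! i, vs ! j) \<in> parcs G)"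
    using assms(1) by (auto simp: matrices_of_def)
  obtain i j where "i < length vs" "vs ! i = u" "j < length vs" "vs ! j = v"
    using assms vs by (metis in_set_conv_nth)
  with adj[of i j] assms show ?thesis
    unfolding q_mat_def by (intro symmetric_offdiagonal_card_spectrum[OF vs(3,4), of i j]) auto
qed

text \<open>The lower bound for \<open>MB\<close>: pulling \<open>S\<close> back along the
  enumeration \<open>vs\<close> reduces it to the matrix bound for the eigenvalue of multiplicity
  \<open>k\<close>.\<close>

lemma achieves_bipartition_independent_card_le:
  assumes "achieves_bipartition G k" and S: "S \<subseteq> pverts G"
    and indep: "\<And>u v. u \<in> S \<Longrightarrow> v \<in> S \<Longrightarrow> (u, v) \<notin> parcs G"
    and nbr: "\<And>u. u \<in> S \<Longrightarrow> \<exists>v\<in>pverts G. v \<noteq> u \<and> (u, v) \<in> parcs G"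
  shows "card S \<le> k"
proof -
  obtain A a b where A: "A \<in> \<S> G" "a \<noteq> b" "spectrum A = {a, b}" "Polynomial.order b (char_poly A) = k"
    using assms(1) by (auto simp: achieves_bipartition_def)
  obtain vs where vs: "distinct vs" "set vs = pverts G" "A \<in> carrier_mat (length vs) (length vs)" "A\<^sup>T = A"
    and adj: "\<And>i j. i < length vs \<Longrightarrow> j < length vs \<Longrightarrow> i \<noteq> j \<Longrightarrow> (A $$ (i, j) \<noteq> 0 \<longleftrightarrow> (vs ! i, vs ! j) \<in> parcs G)"
    using A(1) by (auto simp: matrices_of_def)
  define T where "T = {i. i < length vs \<and> vs ! i \<in> S}"
  have "(!) vs ` T = S" using S vs(2) by (auto simp: T_def image_iff) (metis in_set_conv_nth subsetD)
  moreover have "inj_on ((!) vs) T" using vs(1) by (auto simp: inj_on_def T_def nth_eq_iff_index_eq)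
  ultimately have "card S = card T" by (metis card_image)
  also have "card T \<le> Polynomial.order b (char_poly A)"
  proof (rule symmetric_independent_card_le_multiplicity[OF vs(3,4) A(3,2)])
    fix i assume i: "i \<in> T"
    then obtain v where v: "v \<in> pverts G" "v \<noteq> vs ! i" "(vs ! i, v) \<in> parcs G"
      using nbr[of "vs ! i"] by (auto simp: T_def)
    then obtain j where "j < length vs" "vs ! j = v" using vs(2) by (metis in_set_conv_nth)
    then show "\<exists>j<length vs. j \<noteq> i \<and> A $$ (i, j) \<noteq> 0"
      using adj[of i j] i v by (auto simp: T_def)
  qed (use adj indep in \<open>auto simp: T_def\<close>)
  finally show ?thesis by (simp add: A)
qed

text \<open>The upper bound for \<open>MB\<close>, witnessed by the Gram matrix of the family with
  eigenvalues 0 and \<open>e\<close>. The size condition makes \<open>card I\<close> an admissible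
  smaller multiplicity and, as \<open>I\<close> is nonempty, gives \<open>card I < n\<close>, so
  that 0 does occur.\<close>

lemma orthogonal_family_achieves_bipartition:
  assumes finV: "finite (pverts G)" and I: "finite I" "I \<noteq> {}" "2 * card I \<le> card (pverts G)"
    and orth: "orthogonal_family (pverts G) I (\<lambda>_. e) w"
    and adj: "\<And>u v. u \<in> pverts G \<Longrightarrow> v \<in> pverts G \<Longrightarrow> u \<noteq> v \<Longrightarrow>
      (\<Sum>k\<in>I. w k u * w k v) \<noteq> 0 \<longleftrightarrow> (u, v) \<in> parcs G"
  shows "achieves_bipartition G (card I)" and "\<exists>A\<in>\<S> G. q_mat A = 2"
proof -
  obtain vs where vs: "distinct vs" "set vs = pverts G" using finite_distinct_list[OF finV] by auto
  define n where "n = length vs"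
  have n: "card (pverts G) = n" using vs by (metis distinct_card n_def)
  define f where "f k x = w k (vs ! x)" for k x
  define A where "A = mat n n (\<lambda>(x, y). \<Sum>k\<in>I. f k x * f k y)"
  have A: "A \<in> carrier_mat n n" by (simp add: A_def)
  have gram: "A $$ (x, y) = (\<Sum>k\<in>I. f k x * f k y)" if "x < n" "y < n" for x y
    using that by (simp add: A_def)
  have "(\<Sum>x<n. f k x * f l x) = (\<Sum>v\<in>pverts G. w k v * w l v)" for k l
    using sum_nth_distinct[OF vs, of "\<lambda>v. w k v * w l v"] by (simp add: f_def n_def)
  then have orth': "orthogonal_family {..<n} I (\<lambda>_. e) f"
    using orth by (simp add: orthogonal_family_def)
  have "0 < card I" using I by (simp add: card_gt_0_iff)
  then have "card I < n" using I n by simp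
  note spec = gram_constant_norm_spectrum[OF A I(1) gram orth' refl I(2) this]
  have "A\<^sup>T = A" by (rule eq_matI) (auto simp: A_def mult.commute)
  have "A \<in> \<S> G"
    unfolding matrices_of_def
  proof (intro CollectI exI[of _ vs] conjI allI impI)
    fix i j assume ij: "i < length vs" "j < length vs" "i \<noteq> j"
    then have ne: "vs ! i \<noteq> vs ! j" "vs ! i \<in> pverts G" "vs ! j \<in> pverts G"
      using nth_eq_iff_index_eq[OF vs(1)] nth_mem[of _ vs] unfolding vs(2) by blast+
    have "A $$ (i, j) = (\<Sum>k\<in>I. w k (vs ! i) * w k (vs ! j))"
      using ij gram[of i j] by (simp add: n_def f_def)
    then show "A $$ (i, j) \<noteq> 0 \<longleftrightarrow> (vs ! i, vs ! j) \<in> parcs G" using adj[OF ne(2,3,1)] by simp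
  qed (use vs A \<open>A\<^sup>T = A\<close> in \<open>auto simp: n_def\<close>)
  moreover have e: "e > 0" using orth I(2) by (auto simp: orthogonal_family_def)
  moreover have "q_mat A = 2" using e by (simp add: q_mat_def spec)
  ultimately show "\<exists>A\<in>\<S> G. q_mat A = 2" by blast
  show "achieves_bipartition G (card I)"
    unfolding achieves_bipartition_def n
    using \<open>0 < card I\<close> I(3) n \<open>A \<in> \<S> G\<close> e spec
    by (intro conjI bexI[of _ A] exI[of _ 0] exI[of _ e]) simp_all
qed

text \<open>
  If row \<open>v\<close> vanished on all members of norm \<open>c i\<close>, then the unit vector at \<open>v\<close> would be an
  eigenvector of the Gram matrix, so \<open>v\<close> would be isolated.
\<close>
lemma orthogonal_family_same_norm_nonzero:
  assumes finV: "finite V" and finI: "finite I" and orth: "orthogonal_family V I c g"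
    and two: "card (c ` I) \<le> 2"
    and const: "card I < card V \<Longrightarrow> \<forall>i\<in>I. \<forall>j\<in>I. c i = c j"
    and nbr: "\<exists>u\<in>V. u \<noteq> v \<and> (\<Sum>k\<in>I. g k v * g k u) \<noteq> 0"
    and i: "i \<in> I" and v: "v \<in> V"
  shows "\<exists>j\<in>I. c j = c i \<and> g j v \<noteq> 0"
proof (rule ccontr)
  assume "\<not> ?thesis"
  then have 0: "g j v = 0" if "j \<in> I" "c j = c i" for j using that by blast
  obtain u where u: "u \<in> V" "u \<noteq> v" and nz: "(\<Sum>k\<in>I. g k v * g k u) \<noteq> 0" using nbr by blast
  obtain j where j: "j \<in> I" "g j v * g j u \<noteq> 0" using nz by (metis (no_types, lifting) sum.neutral)
  then have cj: "c j \<noteq> c i" using 0 by auto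
  have other: "c k = c j" if "k \<in> I" "c k \<noteq> c i" for k
  proof (rule ccontr)
    assume "c k \<noteq> c j"
    then have "card {c i, c j, c k} = 3" using cj that by auto
    moreover have "card {c i, c j, c k} \<le> card (c ` I)" using i j that finI by (intro card_mono) auto
    ultimately show False using two by simp
  qed
  \<comment> \<open>A smaller family would have a single norm, but \<open>c j\<close> differs from
    \<open>c i\<close>.\<close>
  have "card I = card V"
    using const i j cj orthogonal_family_card_le[OF finV finI orth] by (metis le_neq_implies_less)
  \<comment> \<open>Members of norm \<open>c i\<close> vanish at \<open>v\<close> and all others
    have norm \<open>c j\<close>, so the Gram entry is \<open>c j\<close> times an off-diagonal
    entry of the identity.\<close>
  have "(\<Sum>k\<in>I. g k v * g k u) = (\<Sum>k\<in>I. c j * (g k v * g k u / c k))"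
  proof (rule sum.cong)
    fix k assume k: "k \<in> I"
    then show "g k v * g k u = c j * (g k v * g k u / c k)"
      using 0[of k] other[of k] orthogonal_familyD(1)[OF orth k] by (cases "c k = c i") auto
  qed simp
  also have "\<dots> = c j * (\<Sum>k\<in>I. g k v * g k u / c k)" by (simp only: sum_distrib_left)
  also have "\<dots> = 0"
    using orthogonal_family_complete[OF finV finI orth \<open>card I = card V\<close> v u(1)] u by simp
  finally show False using nz by simp
qed

lemma q_graph_MB_of_orthogonal_family:
  assumes finV: "finite (pverts G)" and I: "finite I" "I \<noteq> {}" "2 * card I \<le> card (pverts G)"
    and orth: "orthogonal_family (pverts G) I (\<lambda>_. e) w"
    and adj: "\<And>u v. u \<in> pverts G \<Longrightarrow> v \<in> pverts G \<Longrightarrow> u \<noteq> v \<Longrightarrow>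
      (\<Sum>k\<in>I. w k u * w k v) \<noteq> 0 \<longleftrightarrow> (u, v) \<in> parcs G"
    and S: "S \<subseteq> pverts G" "card S = card I"
    and indep: "\<And>u v. u \<in> S \<Longrightarrow> v \<in> S \<Longrightarrow> (u, v) \<notin> parcs G"
    and nbr: "\<And>u. u \<in> S \<Longrightarrow> \<exists>v\<in>pverts G. v \<noteq> u \<and> (u, v) \<in> parcs G"
  shows "q_graph G = 2" and "MB G = card I"
proof -
  note ach = orthogonal_family_achieves_bipartition[OF finV I orth adj]
  have "S \<noteq> {}" using S I by auto
  then obtain u v where "u \<in> pverts G" "v \<in> pverts G" "v \<noteq> u" "(u, v) \<in> parcs G" using nbr S by blast
  then show "q_graph G = 2"
    unfolding q_graph_def using ach(2)
    by (intro cInf_eq_minimum) (auto simp: image_iff intro: matrices_of_edge_q_mat)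
  show "MB G = card I"
    unfolding MB_def
  \<comment> \<open>\<open>card I\<close> itself is achieved, so the infimum is a genuine minimum
    and not the default value on the empty set.\<close>
  proof (rule cInf_eq_minimum)
    show "card I \<le> k" if "k \<in> {k. achieves_bipartition G k}" for k
      using achieves_bipartition_independent_card_le[OF _ S(1) indep nbr, of k] that S(2) by simp
  qed (use ach(1) in simp)
qed

text \<open>Each vertex of clique \<open>i\<close> gets the row with \<open>t i\<close> in column
  \<open>i\<close> and 0 elsewhere. Row products are then positive within a clique, zero between
  cliques, and \<open>f i v * t i\<close> against a vertex \<open>v\<close> of \<open>G\<close>,
  nonzero because \<open>f\<close> has no zeros.\<close>

lemma orthogonal_family_join_cliques:
  fixes G :: "'a pair_pre_digraph" and d :: nat and s :: "nat \<Rightarrow> nat"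
  defines "J \<equiv> graph_join G (disjoint_union {1..d} (\<lambda>i. complete_graph (s i)))"
  assumes finV: "finite (pverts G)" and s: "\<forall>i\<in>{1..d}. s i > 0"
    and orth: "orthogonal_family (pverts G) {1..d} c f"
    and nz: "\<And>i v. i \<in> {1..d} \<Longrightarrow> v \<in> pverts G \<Longrightarrow> f i v \<noteq> 0"
    and adj: "\<And>u v. u \<in> pverts G \<Longrightarrow> v \<in> pverts G \<Longrightarrow> u \<noteq> v \<Longrightarrow>
      (\<Sum>k\<in>{1..d}. f k u * f k v) \<noteq> 0 \<longleftrightarrow> (u, v) \<in> parcs G"
  obtains w e where "orthogonal_family (pverts J) {1..d} (\<lambda>_. e) w"
    "\<And>x y. x \<in> pverts J \<Longrightarrow> y \<in> pverts J \<Longrightarrow> x \<noteq> y \<Longrightarrow>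
      (\<Sum>k\<in>{1..d}. w k x * w k y) \<noteq> 0 \<longleftrightarrow> (x, y) \<in> parcs J"
proof -
  let ?I = "{1..d}"
  define W where "W = (SIGMA i:?I. {..<s i})"
  have finW: "finite W" by (simp add: W_def)
  have VJ: "pverts J = pverts G <+> W"
    by (simp add: J_def graph_join_def disjoint_union_def complete_graph_def W_def)
  \<comment> \<open>The common squared norm must exceed every \<open>c i\<close>, so that each
    clique has a positive amount left to contribute.\<close>
  define e where "e = (\<Sum>i\<in>?I. c i) + 1"
  have cpos: "c i > 0" if "i \<in> ?I" for i using orthogonal_familyD(1)[OF orth that] .
  have ce: "c i < e" if "i \<in> ?I" for i
    using member_le_sum[of i ?I c] that cpos by (force simp: e_def)
  have e: "e > 0" using sum_nonneg[of ?I c] cpos by (force simp: e_def)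
  \<comment> \<open>The \<open>s i\<close> vertices of clique \<open>i\<close> together add
    \<open>e - c i\<close> to the squared norm of column \<open>i\<close>.\<close>
  define t where "t i = sqrt ((e - c i) / s i)" for i
  have t: "t i > 0" "real (s i) * (t i * t i) = e - c i" if "i \<in> ?I" for i
    using ce[OF that] s that by (auto simp: t_def)
  define w :: "nat \<Rightarrow> 'a + nat \<times> nat \<Rightarrow> real" where
    "w k x = (case x of Inl v \<Rightarrow> f k v | Inr (i, u) \<Rightarrow> if i = k then t k else 0)" for k x
  have wr: "w k (Inr p) = (if fst p = k then t k else 0)" and wl: "w k (Inl v) = f k v" for k p v
    by (auto simp: w_def split: prod.split)
  show thesis
  proof
    show "orthogonal_family (pverts J) ?I (\<lambda>_. e) w"
      unfolding orthogonal_family_def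
    proof (intro ballI conjI)
      fix k l assume k: "k \<in> ?I" and l: "l \<in> ?I"
      have "(\<Sum>p\<in>W. w k (Inr p) * w l (Inr p)) = (\<Sum>i\<in>?I. \<Sum>u<s i. w k (Inr (i, u)) * w l (Inr (i, u)))"
        unfolding W_def by (simp add: sum.Sigma)
      also have "\<dots> = (\<Sum>i\<in>?I. if i = k then (if k = l then e - c k else 0) else 0)"
        by (rule sum.cong) (use t(2)[OF k] in \<open>auto simp: wr\<close>)
      also have "\<dots> = (if k = l then e - c k else 0)" using k by simp
      finally have "(\<Sum>p\<in>W. w k (Inr p) * w l (Inr p)) = (if k = l then e - c k else 0)" .
      then show "(\<Sum>x\<in>pverts J. w k x * w l x) = (if k = l then e else 0)"
        using orthogonal_familyD(3)[OF orth k l] by (simp add: VJ sum.Plus[OF finV finW] wl)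
    qed (simp add: e)
    fix x y assume x: "x \<in> pverts J" and y: "y \<in> pverts J" and xy: "x \<noteq> y"
    have cross: "(\<Sum>k\<in>?I. f k v * w k (Inr (i, u))) \<noteq> 0" if "v \<in> pverts G" "i \<in> ?I" for v i u
    proof -
      have "(\<Sum>k\<in>?I. f k v * w k (Inr (i, u))) = (\<Sum>k\<in>?I. if k = i then f i v * t i else 0)"
        by (rule sum.cong) (auto simp: wr)
      then show ?thesis using nz[OF that(2,1)] t[OF that(2)] that by simp
    qed
    have clique: "(\<Sum>k\<in>?I. w k (Inr (i, u)) * w k (Inr (j, v))) \<noteq> 0 \<longleftrightarrow> i = j" if "i \<in> ?I" for i j u v
    proof -
      have "(\<Sum>k\<in>?I. w k (Inr (i, u)) * w k (Inr (j, v)))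
          = (\<Sum>k\<in>?I. if k = i then (if i = j then t i * t i else 0) else 0)"
        by (rule sum.cong) (auto simp: wr)
      then show ?thesis using t(1)[OF that] that by auto
    qed
    show "(\<Sum>k\<in>?I. w k x * w k y) \<noteq> 0 \<longleftrightarrow> (x, y) \<in> parcs J"
    proof (cases x)
      case x': (Inl u)
      show ?thesis
      proof (cases y)
        case (Inl v)
        then show ?thesis using adj[of u v] x y xy x' by (auto simp: wl VJ J_def graph_join_def)
      next
        case (Inr p)
        then show ?thesis using cross[of u "fst p" "snd p"] x y x'
          by (auto simp: wl VJ J_def graph_join_def disjoint_union_def complete_graph_def W_def)
      qed
    next
      case x': (Inr p)
      show ?thesis
      proof (cases y)
        case (Inl v)
        then show ?thesis using cross[of v "fst p" "snd p"] x y x'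
          by (auto simp: wl VJ J_def graph_join_def disjoint_union_def complete_graph_def W_def mult.commute)
      next
        case (Inr q)
        then show ?thesis using clique[of "fst p" "snd p" "fst q" "snd q"] x y xy x'
          by (auto simp: VJ J_def graph_join_def disjoint_union_def complete_graph_def W_def)
      qed
    qed
  qed
qed

section \<open>The columns of \<open>Z\<close> and the join with the cliques\<close>

theorem lemma3p4:
  fixes G :: "'a pair_pre_digraph" and d :: nat and s :: "nat \<Rightarrow> nat"
    and z :: "nat \<Rightarrow> real vec" and Z :: "real mat"
  assumes "pair_graph G" and "no_isolated_vertices G"
    and "d > 0" and "\<forall>i\<in>{1..d}. s i > 0"
    and "0 < mr_plus G" and "mr_plus G \<le> d" and "d \<le> card (pverts G)"
    and "\<forall>i\<in>{1..d}. z i \<in> carrier_vec (card (pverts G))"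
    and "orthogonal (map z [1..<Suc d])"
    and "Z = mat_of_cols (card (pverts G)) (map z [1..<Suc d])"
    and "Z * Z\<^sup>T \<in> \<S> G" and "q_mat (Z * Z\<^sup>T) = 2"
  shows "q_graph (graph_join G (disjoint_union {1..d} (\<lambda>i. complete_graph (s i)))) = 2
       \<and> MB (graph_join G (disjoint_union {1..d} (\<lambda>i. complete_graph (s i)))) = d"
proof -
  interpret pair_graph G by fact
  note finV = pair_finite_verts
  define n where "n = card (pverts G)"
  define A where "A = Z * Z\<^sup>T"
  let ?I = "{1..d}"
  have z: "z i \<in> carrier_vec n" if "i \<in> ?I" for i using assms(8) that by (simp add: n_def)
  have Z: "Z \<in> carrier_mat n d" using assms(10) by (simp add: n_def mat_of_cols_def del: upt_Suc)
  have A: "A \<in> carrier_mat n n" using Z by (simp add: A_def)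
  have gram: "A $$ (x, y) = (\<Sum>k\<in>?I. z k $ x * z k $ y)" if "x < n" "y < n" for x y
  proof -
    have "A $$ (x, y) = (\<Sum>k<d. Z $$ (x, k) * Z $$ (y, k))"
      using that Z by (simp add: A_def scalar_prod_def lessThan_atLeast0)
    also have "\<dots> = (\<Sum>k<d. z (Suc k) $ x * z (Suc k) $ y)"
      by (rule sum.cong) (use that assms(10) in \<open>auto simp: mat_of_cols_index n_def simp del: upt_Suc\<close>)
    also have "\<dots> = (\<Sum>k\<in>?I. z k $ x * z k $ y)" by (simp only: sum.atLeast1_atMost_eq One_nat_def)
    finally show ?thesis .
  qed
  define c where "c i = z i \<bullet> z i" for i
  have orthz: "z i \<bullet> z j = 0 \<longleftrightarrow> i \<noteq> j" if "i \<in> ?I" "j \<in> ?I" for i j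
  proof -
    \<comment> \<open>The list of columns is indexed from 0, the vectors \<open>z\<close> from
      1.\<close>
    define i' j' where "i' = i - 1" and "j' = j - 1"
    then have "i = Suc i'" "i' < d" "j = Suc j'" "j' < d" using that by auto
    then show ?thesis using orthogonalD[OF assms(9), of i' j'] by (simp del: upt_Suc)
  qed
  have dot: "(\<Sum>x<n. z i $ x * z j $ x) = z i \<bullet> z j" if "i \<in> ?I" "j \<in> ?I" for i j
    using z[OF that(2)] by (simp add: scalar_prod_def lessThan_atLeast0)
  have orth: "orthogonal_family {..<n} ?I c (\<lambda>i x. z i $ x)"
    unfolding orthogonal_family_def
  proof (intro ballI conjI)
    fix i j assume i: "i \<in> ?I"
    \<comment> \<open>\<open>orthogonal\<close> also states that \<open>z i\<close> has nonzero
      product with itself, which turns nonnegativity into positivity.\<close>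
    have "0 \<le> c i" unfolding c_def dot[OF i i, symmetric] by (rule sum_nonneg) simp
    then show "0 < c i" using orthz[OF i i] by (simp add: c_def)
    assume "j \<in> ?I"
    with i show "(\<Sum>x<n. z i $ x * z j $ x) = (if i = j then c i else 0)"
      using orthz[of i j] dot[of i j] by (auto simp: c_def)
  qed
  have fin: "finite ?I" by simp
  have spec: "finite (spectrum A)" "card (spectrum A) = 2"
    using card_finite_spectrum(1)[OF A] assms(12) by (auto simp: q_mat_def A_def)
  have cspec: "c ` ?I \<subseteq> spectrum A" using gram_norm_in_spectrum[OF A fin gram orth] by blast
  then have two: "card (c ` ?I) \<le> 2" using spec by (metis card_mono)
  \<comment> \<open>With fewer columns than rows, 0 is an eigenvalue, so two distinct positive norms
    would give a third one.\<close>
  have const: "\<forall>i\<in>?I. \<forall>j\<in>?I. c i = c j" if "d < n"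
  proof (intro ballI, rule ccontr)
    fix i j assume ij: "i \<in> ?I" "j \<in> ?I" and "c i \<noteq> c j"
    then have "card {0, c i, c j} = 3"
      using orthogonal_familyD(2)[OF orth ij(1)] orthogonal_familyD(2)[OF orth ij(2)] by auto
    moreover have "card {0, c i, c j} \<le> card (spectrum A)"
      using gram_zero_in_spectrum[OF A fin gram orth] cspec ij that spec(1) by (intro card_mono) auto
    ultimately show False using spec by simp
  qed
  obtain vs where vs: "distinct vs" "set vs = pverts G" "A \<in> carrier_mat (length vs) (length vs)"
    and Aadj: "\<And>i j. i < length vs \<Longrightarrow> j < length vs \<Longrightarrow> i \<noteq> j \<Longrightarrow> (A $$ (i, j) \<noteq> 0 \<longleftrightarrow> (vs ! i, vs ! j) \<in> parcs G)"
    using assms(11) by (auto simp: matrices_of_def A_def)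
  have len: "length vs = n" using A vs(3) by auto
  \<comment> \<open>The inverse of the enumeration that witnesses membership of \<open>A\<close> in
    \<open>\<S> G\<close>; it moves the columns from matrix indices to vertices.\<close>
  define idx where "idx v = (THE i. i < n \<and> vs ! i = v)" for v
  have idx_nth: "idx (vs ! i) = i" if "i < n" for i
    unfolding idx_def using vs(1) len that by (intro the_equality) (auto simp: nth_eq_iff_index_eq)
  have idx: "idx v < n" "vs ! idx v = v" if "v \<in> pverts G" for v
  proof -
    obtain i where "i < n" "vs ! i = v" using \<open>v \<in> pverts G\<close> vs(2) len by (metis in_set_conv_nth)
    then show "idx v < n" "vs ! idx v = v" using idx_nth by auto
  qed
  define f where "f k v = z k $ idx v" for k v
  have "(\<Sum>v\<in>pverts G. f i v * f j v) = (\<Sum>x<n. z i $ x * z j $ x)" for i j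
  proof -
    have "(\<Sum>x<n. f i (vs ! x) * f j (vs ! x)) = (\<Sum>v\<in>pverts G. f i v * f j v)"
      using sum_nth_distinct[OF vs(1,2), of "\<lambda>v. f i v * f j v"] len by simp
    then show ?thesis by (simp add: f_def idx_nth)
  qed
  then have orthf: "orthogonal_family (pverts G) ?I c f"
    using orth by (simp add: orthogonal_family_def)
  have adjf: "(\<Sum>k\<in>?I. f k u * f k v) \<noteq> 0 \<longleftrightarrow> (u, v) \<in> parcs G"
    if "u \<in> pverts G" "v \<in> pverts G" "u \<noteq> v" for u v
  proof -
    have "idx u \<noteq> idx v" using idx that by metis
    then show ?thesis
      using Aadj[of "idx u" "idx v"] gram[of "idx u" "idx v"] idx that len by (simp add: f_def)
  qed
  have nbr: "\<exists>u\<in>pverts G. u \<noteq> v \<and> (\<Sum>k\<in>?I. f k v * f k u) \<noteq> 0" if "v \<in> pverts G" for v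
  proof -
    obtain u where u: "u \<in> pverts G" "(v, u) \<in> parcs G"
      using assms(2) \<open>v \<in> pverts G\<close> by (auto simp: no_isolated_vertices_def)
    then have "u \<noteq> v" using pair_no_loops[of "(v, u)"] by auto
    then show ?thesis using u adjf[OF that u(1)] by auto
  qed
  obtain g where g: "orthogonal_family (pverts G) ?I c g"
    and gf: "\<And>u v. (\<Sum>k\<in>?I. g k u * g k v) = (\<Sum>k\<in>?I. f k u * f k v)"
    and gnz: "\<And>i v. i \<in> ?I \<Longrightarrow> v \<in> pverts G \<Longrightarrow> g i v \<noteq> 0"
  proof (rule orthogonal_family_nowhere_zero[OF finV fin orthf])
    \<comment> \<open>The nonvanishing condition has to hold for every rotated family
      \<open>h\<close>; it does, because it depends only on the norms and the Gram sums, which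
      \<open>h\<close> shares with \<open>f\<close>.\<close>
    fix h i v assume h: "orthogonal_family (pverts G) ?I c h"
      and hf: "\<And>u v. (\<Sum>k\<in>?I. h k u * h k v) = (\<Sum>k\<in>?I. f k u * f k v)"
      and iv: "i \<in> ?I" "v \<in> pverts G"
    show "\<exists>j\<in>?I. c j = c i \<and> h j v \<noteq> 0"
    proof (rule orthogonal_family_same_norm_nonzero[OF finV fin h two _ _ iv])
      show "\<forall>i\<in>?I. \<forall>j\<in>?I. c i = c j" if "card ?I < card (pverts G)"
        using that by (intro const) (simp add: n_def)
      show "\<exists>u\<in>pverts G. u \<noteq> v \<and> (\<Sum>k\<in>?I. h k v * h k u) \<noteq> 0"
        unfolding hf by (rule nbr[OF iv(2)])
    qed
  qed blast
  have adjg: "(\<Sum>k\<in>?I. g k u * g k v) \<noteq> 0 \<longleftrightarrow> (u, v) \<in> parcs G"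
    if "u \<in> pverts G" "v \<in> pverts G" "u \<noteq> v" for u v
    unfolding gf by (rule adjf[OF that])
  define J where "J = graph_join G (disjoint_union ?I (\<lambda>i. complete_graph (s i)))"
  obtain w e where w: "orthogonal_family (pverts J) ?I (\<lambda>_. e) w"
    and adjw: "\<And>x y. x \<in> pverts J \<Longrightarrow> y \<in> pverts J \<Longrightarrow> x \<noteq> y \<Longrightarrow>
      (\<Sum>k\<in>?I. w k x * w k y) \<noteq> 0 \<longleftrightarrow> (x, y) \<in> parcs J"
  proof (rule orthogonal_family_join_cliques[OF finV assms(4) g gnz adjg, folded J_def])
    fix w e assume 1: "orthogonal_family (pverts J) ?I (\<lambda>_. e) w"
      and 2: "\<And>x y. x \<in> pverts J \<Longrightarrow> y \<in> pverts J \<Longrightarrow> x \<noteq> y \<Longrightarrow>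
        (\<Sum>k\<in>?I. w k x * w k y) \<noteq> 0 \<longleftrightarrow> (x, y) \<in> parcs J"
    show thesis by (rule that[OF 1 2])
  qed
  have VJ: "pverts J = pverts G <+> (SIGMA i:?I. {..<s i})"
    by (simp add: J_def graph_join_def disjoint_union_def complete_graph_def)
  have finJ: "finite (pverts J)" using finV by (simp add: VJ)
  \<comment> \<open>The cliques have at least \<open>d\<close> vertices in total and
    \<open>G\<close> has at least \<open>d\<close>, so \<open>d\<close> is at most half the order of
    the join.\<close>
  have "(\<Sum>i\<in>?I. 1) \<le> (\<Sum>i\<in>?I. s i)" by (rule sum_mono) (use assms(4) in force)
  then have "2 * card ?I \<le> card (pverts J)"
    using assms(7) finV by (simp add: VJ card_Plus)
  \<comment> \<open>One vertex from each clique, namely the vertex 0, present since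
    \<open>s i > 0\<close>. These are pairwise nonadjacent, and each is joined to every vertex of
    \<open>G\<close>.\<close>
  define S where "S = (\<lambda>i. Inr (i, 0) :: 'a + nat \<times> nat) ` ?I"
  have S: "S \<subseteq> pverts J" "card S = card ?I"
    using assms(4) by (auto simp: S_def VJ card_image inj_on_def)
  have indep: "(x, y) \<notin> parcs J" if "x \<in> S" "y \<in> S" for x y
    using that by (auto simp: S_def J_def graph_join_def disjoint_union_def complete_graph_def)
  obtain v where v: "v \<in> pverts G" using assms(3,7) by fastforce
  have nbrJ: "\<exists>y\<in>pverts J. y \<noteq> x \<and> (x, y) \<in> parcs J" if "x \<in> S" for x
  proof (intro bexI conjI)
    show "(x, Inl v) \<in> parcs J"
      using that v assms(4) by (auto simp: S_def J_def graph_join_def disjoint_union_def complete_graph_def)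
    show "Inl v \<noteq> x" using that by (auto simp: S_def)
  qed (use v in \<open>auto simp: VJ\<close>)
  have "?I \<noteq> {}" using assms(3) by simp
  from q_graph_MB_of_orthogonal_family[OF finJ fin this \<open>2 * card ?I \<le> card (pverts J)\<close> w adjw S indep nbrJ]
  show ?thesis by (simp add: J_def)
qed

end
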